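(* Every $C_3^*$-critical signed graph $(G,\sigma)$ satisfies $|E(G)|\geq \frac{3|V(G)|-1}{2}$.
   Context: All graphs are finite and may have multiple edges or loops. A signed graph $(G,\sigma)$ is a graph $G$ together with a signature $\sigma:E(G)\to\{+,-\}$. A digon is a pair of parallel edges with different signs. A subgraph of a signed graph carries the restricted signature. The sign of a closed walk is the product of the signs of its edges (with repetition). A homomorphism of $(G,\sigma)$ to $(H,\pi)$ is a mapping $V(G)\to V(H)$ that preserves adjacency and the signs of all closed walks; write $(G,\sigma)\to(H,\pi)$ if one exists. Equivalently, after switching some set of vertices of $(G,\sigma)$ (switching at $v$ multiplies the signs of all non-loop edges incident to $v$ by $-$), there is a vertex mapping preserving adjacency and the signs of edges. $C_3^*$ is the signed graph on three vertices consisting of a triangle with all three edges positive, together with a negative loop at each vertex. A signed graph $\hat G$ is $C_3^*$-critical if it has no digon and no positive loop, $\hat G\not\to C_3^*$, and $\hat G'\to C_3^*$ for every proper subgraph $\hat G'$ of $\hat G$. *)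

theory Defs
  imports Complex_Main "HOL-Library.FuncSet"
begin

text \<open>Undirected multigraphs: edges are names of their own, so parallel edges are distinct
  elements of \<open>edges\<close>. The ends of an edge form a two-element set, or a singleton for a loop.
  Signs are \<open>1\<close> and \<open>-1\<close>.\<close>

record ('v, 'e) signed_graph =
  verts :: "'v set"
  edges :: "'e set"
  ends :: "'e \<Rightarrow> 'v set"
  esign :: "'e \<Rightarrow> int"

definition signed_graph :: "('v, 'e) signed_graph \<Rightarrow> bool" where
  "signed_graph G \<longleftrightarrow>
     finite (verts G) \<and> finite (edges G) \<and>
     (\<forall>e\<in>edges G. ends G e \<subseteq> verts G \<and> card (ends G e) \<in> {1, 2} \<and> esign G e \<in> {1, -1})"

definition has_digon :: "('v, 'e) signed_graph \<Rightarrow> bool" where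
  "has_digon G \<longleftrightarrow>
     (\<exists>e\<in>edges G. \<exists>e'\<in>edges G. ends G e = ends G e' \<and> esign G e \<noteq> esign G e')"

definition has_positive_loop :: "('v, 'e) signed_graph \<Rightarrow> bool" where
  "has_positive_loop G \<longleftrightarrow> (\<exists>e\<in>edges G. card (ends G e) = 1 \<and> esign G e = 1)"

definition subgraph :: "('v, 'e) signed_graph \<Rightarrow> ('v, 'e) signed_graph \<Rightarrow> bool" where
  "subgraph H G \<longleftrightarrow>
     signed_graph H \<and> signed_graph G \<and> verts H \<subseteq> verts G \<and> edges H \<subseteq> edges G \<and>
     (\<forall>e\<in>edges H. ends H e = ends G e \<and> esign H e = esign G e)"

text \<open>Properness is not \<open>H \<noteq> G\<close>: the fields \<open>ends\<close> and \<open>esign\<close> carry irrelevant values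
  outside \<open>edges\<close>.\<close>

definition proper_subgraph :: "('v, 'e) signed_graph \<Rightarrow> ('v, 'e) signed_graph \<Rightarrow> bool" where
  "proper_subgraph H G \<longleftrightarrow> subgraph H G \<and> (verts H \<noteq> verts G \<or> edges H \<noteq> edges G)"

text \<open>A walk from \<open>u\<close> to \<open>v\<close>, given by its sequence of edges; the start vertex and the edges
  determine the intermediate vertices.\<close>

fun walk :: "('v, 'e) signed_graph \<Rightarrow> 'v \<Rightarrow> 'e list \<Rightarrow> 'v \<Rightarrow> bool" where
  "walk G u [] v \<longleftrightarrow> u \<in> verts G \<and> u = v"
| "walk G u (e # es) v \<longleftrightarrow> e \<in> edges G \<and> (\<exists>w. ends G e = {u, w} \<and> walk G w es v)"

definition walk_sign :: "('v, 'e) signed_graph \<Rightarrow> 'e list \<Rightarrow> int" where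
  "walk_sign G es = prod_list (map (esign G) es)"

text \<open>In a multigraph the image of a walk under a vertex map \<open>f\<close> is determined only once each
  edge with ends \<open>u\<close>, \<open>v\<close> has been assigned an edge with ends \<open>f u\<close>, \<open>f v\<close>; the map \<open>g\<close> is
  this assignment, and its existence is preservation of adjacency. It is unique if the target
  has no parallel edges.\<close>

definition homomorphism ::
    "('v, 'e) signed_graph \<Rightarrow> ('w, 'd) signed_graph \<Rightarrow> ('v \<Rightarrow> 'w) \<Rightarrow> bool" where
  "homomorphism G H f \<longleftrightarrow>
     f \<in> verts G \<rightarrow> verts H \<and>
     (\<exists>g \<in> edges G \<rightarrow> edges H.
        (\<forall>e\<in>edges G. ends H (g e) = f ` ends G e) \<and>
        (\<forall>v es. walk G v es v \<longrightarrow> walk_sign H (map g es) = walk_sign G es))"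

definition maps_to :: "('v, 'e) signed_graph \<Rightarrow> ('w, 'd) signed_graph \<Rightarrow> bool" where
  "maps_to G H \<longleftrightarrow> (\<exists>f. homomorphism G H f)"

text \<open>The positive triangle with a negative loop at each vertex; having no parallel edges, it
  can use the sets of ends themselves as edges.\<close>

definition C3star :: "(nat, nat set) signed_graph" where
  "C3star =
     \<lparr>verts = {0, 1, 2},
      edges = {{0, 1}, {1, 2}, {0, 2}, {0}, {1}, {2}},
      ends = (\<lambda>e. e),
      esign = (\<lambda>e. if card e = 1 then -1 else 1)\<rparr>"

definition C3star_critical :: "('v, 'e) signed_graph \<Rightarrow> bool" where
  "C3star_critical G \<longleftrightarrow>
     signed_graph G \<and> \<not> has_digon G \<and> \<not> has_positive_loop G \<and>
     \<not> maps_to G C3star \<and> (\<forall>G'. proper_subgraph G' G \<longrightarrow> maps_to G' C3star)"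

end

theory Submission
  imports Defs
begin

text \<open>The proof is by the potential method with \<open>pot S = 3 |S| - 2 |E(S)|\<close>. A vertex-minimal
  counterexample is a digon-free vertex-critical graph with \<open>pot V \<ge> 2\<close>. Contracting a coloured
  proper subgraph along its at most three colour classes shows that every vertex set with at least
  four vertices and at least two vertices missing has potential at least 4. Consequently one
  further edge can be imposed on such a subgraph without destroying colourability, unless the edge
  creates a digon.

  Charge every vertex with 6 minus twice its degree; the total is \<open>2 pot V \<ge> 4\<close>. Vertices of
  degree two are pairwise nonadjacent and give 1 to each neighbour. Then only two kinds of vertices
  keep positive charge, both with charge 1: those with two neighbours of degree at least three and
  one of degree two (type A), and those with one and three, respectively (type B). Imposing extra
  edges shows that a type A vertex lies in a positive triangle with its two strong neighbours, and
  that the strong neighbour of a type B vertex is adjacent to the far ends of its weak neighbours.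
  In the first case recolouring makes the total charge of the triangle nonpositive, in the second
  the strong neighbour can pay for its type B neighbours. So the total charge is at most 0.\<close>

section \<open>Colourings by residues modulo 6\<close>

text \<open>The bound on the number of edges amounts to \<open>pot V \<le> 1\<close>, whereas a
  nonempty set of at most three vertices always has potential at least 3; the gap for proper subsets
  rests on this difference of 2. The obstacle to contraction is a digon: an outside vertex with two
  neighbours in the contracted set could end up with two edges of opposite sign to one vertex. Such
  a vertex is absorbed into the set instead, which lowers the potential by only 1, while a
  contraction lowers it by 2. An absorption that completes the whole vertex set yields just 3; this
  is why the bound 4 asks for two missing vertices. The value 4 is what an extra edge requires: the
  edge costs 2 and a noncolourable critical piece has potential at most 1, so at most 3 without the
  edge. The combinatorial part speaks of two relations on a vertex type, adjacency and positivity.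
  Contractions are then graphs on a subset of the same vertices, and the induction hypothesis
  applies to them without a change of type.\<close>

text \<open>A colour is an integer modulo 6. Its class modulo 3 is the image vertex in the target and its
  parity records switching, so a positive edge needs colours at circular distance at least 2 and
  a negative edge colours at distance at most 1.\<close>

definition far :: "int \<Rightarrow> bool" where
  "far d \<longleftrightarrow> d mod 6 \<in> {2, 3, 4}"

lemma mod_6_cases: "(d :: int) mod 6 \<in> {0, 1, 2, 3, 4, 5}"
proof -
  have "0 \<le> d mod 6" "d mod 6 < 6" by simp_all
  then show ?thesis by auto
qed

lemma far_minus_commute: "far (a - b) = far (b - a)"
  using mod_6_cases[of "b - a"] zmod_zminus1_eq_if[of "b - a" 6] unfolding far_def by auto

text \<open>The far residues 2, 3, 4 and the near residues 5, 0, 1 are antipodal. Adding 3 to the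
  colour of one end therefore flips the constraint of an edge, which is how colours express
  switching.\<close>

lemma far_add_3: "far (d + 3) \<longleftrightarrow> \<not> far d"
  using mod_6_cases[of d] mod_add_left_eq[of d 6 3] unfolding far_def by auto

lemma far_0 [simp]: "\<not> far 0"
  unfolding far_def by simp

lemma far_cong: "a mod 6 = b mod 6 \<Longrightarrow> far a = far b"
  unfolding far_def by simp

section \<open>Edge counts, potential and colourability of vertex sets\<close>

definition nb :: "('v \<Rightarrow> 'v \<Rightarrow> bool) \<Rightarrow> 'v set \<Rightarrow> 'v \<Rightarrow> 'v set" where
  "nb adj S v = {w \<in> S. adj v w}"

definition links :: "('v \<Rightarrow> 'v \<Rightarrow> bool) \<Rightarrow> 'v set \<Rightarrow> 'v set \<Rightarrow> nat" where
  "links adj A B = (\<Sum>a\<in>A. card (nb adj B a))"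

text \<open>Since \<open>links adj S S\<close> counts every edge inside \<open>S\<close> twice, this is \<open>3 |S| - 2 |E(S)|\<close>.\<close>

definition pot :: "('v \<Rightarrow> 'v \<Rightarrow> bool) \<Rightarrow> 'v set \<Rightarrow> int" where
  "pot adj S = 3 * int (card S) - int (links adj S S)"

definition good :: "('v \<Rightarrow> 'v \<Rightarrow> bool) \<Rightarrow> ('v \<Rightarrow> 'v \<Rightarrow> bool) \<Rightarrow> ('v \<Rightarrow> int) \<Rightarrow> 'v set \<Rightarrow> bool" where
  "good adj sg f S \<longleftrightarrow> (\<forall>u\<in>S. \<forall>v\<in>S. adj u v \<longrightarrow> far (f u - f v) = sg u v)"

definition colorable :: "('v \<Rightarrow> 'v \<Rightarrow> bool) \<Rightarrow> ('v \<Rightarrow> 'v \<Rightarrow> bool) \<Rightarrow> 'v set \<Rightarrow> bool" where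
  "colorable adj sg S \<longleftrightarrow> (\<exists>f. good adj sg f S)"

definition simple_signed :: "('v \<Rightarrow> 'v \<Rightarrow> bool) \<Rightarrow> ('v \<Rightarrow> 'v \<Rightarrow> bool) \<Rightarrow> bool" where
  "simple_signed adj sg \<longleftrightarrow>
     (\<forall>u v. adj u v = adj v u) \<and> (\<forall>v. \<not> adj v v) \<and> (\<forall>u v. sg u v = sg v u)"

lemma nb_Un: "nb adj (A \<union> B) v = nb adj A v \<union> nb adj B v"
  unfolding nb_def by auto

lemma links_Un_left:
  "finite A \<Longrightarrow> finite B \<Longrightarrow> A \<inter> B = {} \<Longrightarrow> links adj (A \<union> B) C = links adj A C + links adj B C"
  unfolding links_def by (rule sum.union_disjoint)

lemma links_Un_right:
  assumes "finite B" "finite C" "B \<inter> C = {}"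
  shows "links adj A (B \<union> C) = links adj A B + links adj A C"
proof -
  have "card (nb adj (B \<union> C) a) = card (nb adj B a) + card (nb adj C a)" for a
    unfolding nb_Un by (rule card_Un_disjoint) (use assms in \<open>auto simp: nb_def\<close>)
  then show ?thesis unfolding links_def by (simp add: sum.distrib)
qed

lemma links_commute:
  assumes "finite A" "finite B" "\<And>u v. adj u v = adj v u"
  shows "links adj A B = links adj B A"
proof -
  have c: "card (nb adj B a) = (\<Sum>b\<in>B. if adj a b then 1 else 0)" if "finite B" for a B
    using that by (simp add: nb_def sum.If_cases Int_def)
  show ?thesis
    unfolding links_def using assms by (simp add: c sum.swap[of _ B A])
qed

lemma pot_Un:
  assumes "finite A" "finite B" "A \<inter> B = {}" "\<And>u v. adj u v = adj v u"
  shows "pot adj (A \<union> B) = pot adj A + pot adj B - 2 * int (links adj A B)"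
proof -
  have "links adj (A \<union> B) (A \<union> B)
      = links adj A A + links adj A B + (links adj B A + links adj B B)"
    using assms by (simp add: links_Un_left links_Un_right)
  then show ?thesis
    using assms links_commute[of A B adj] unfolding pot_def
    by (simp add: card_Un_disjoint)
qed

lemma pot_insert:
  assumes "finite S" "t \<notin> S" "simple_signed adj sg"
  shows "pot adj (insert t S) = pot adj S + 3 - 2 * int (card (nb adj S t))"
proof -
  have "pot adj {t} = 3"
    using assms(3) unfolding pot_def links_def nb_def simple_signed_def by simp
  moreover have "links adj {t} S = card (nb adj S t)" unfolding links_def by simp
  moreover have "pot adj ({t} \<union> S) = pot adj {t} + pot adj S - 2 * int (links adj {t} S)"
    using assms unfolding simple_signed_def by (intro pot_Un) auto
  ultimately show ?thesis by simp
qed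

lemma pot_empty [simp]: "pot adj {} = 0"
  unfolding pot_def links_def by simp

lemma pot_insert_le:
  assumes "finite S" "t \<notin> S" "simple_signed adj sg" "Z \<subseteq> nb adj S t" "card Z = k"
  shows "pot adj (insert t S) \<le> pot adj S + 3 - 2 * int k"
proof -
  have "finite (nb adj S t)" using assms(1) unfolding nb_def by simp
  then have "k \<le> card (nb adj S t)" using assms(4,5) card_mono by blast
  then show ?thesis using pot_insert[OF assms(1-3)] by simp
qed

text \<open>The bound is the value of a complete graph: 3, 4, 3 for one, two and three vertices, but
  0 for four. Small nonempty sets thus have potential at least 3, and the gap lemmas start at four
  vertices.\<close>

lemma pot_ge:
  assumes "finite S" "simple_signed adj sg"
  shows "pot adj S \<ge> int (card S) * (4 - int (card S))"
proof -
  have "card (nb adj S v) \<le> card S - 1" if "v \<in> S" for v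
  proof -
    have "nb adj S v \<subseteq> S - {v}" using assms(2) unfolding nb_def simple_signed_def by auto
    then show ?thesis
      using card_mono[of "S - {v}" "nb adj S v"] assms(1) that by simp
  qed
  then have "links adj S S \<le> card S * (card S - 1)"
    unfolding links_def by (metis sum_bounded_above of_nat_id)
  then have "int (links adj S S) \<le> int (card S * (card S - 1))" by (rule of_nat_mono)
  also have "\<dots> = int (card S) * (int (card S) - 1)"
    by (cases "card S") (simp_all add: algebra_simps)
  finally have "int (links adj S S) \<le> int (card S) * (int (card S) - 1)" .
  then show ?thesis unfolding pot_def by (simp add: algebra_simps)
qed

lemma critical_subset:
  assumes "finite S" "\<not> colorable adj sg S"
  obtains T where "T \<subseteq> S" "\<not> colorable adj sg T" "\<And>R. R \<subset> T \<Longrightarrow> colorable adj sg R"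
proof -
  have "\<exists>T. T \<subseteq> S \<and> \<not> colorable adj sg T \<and> (\<forall>R. R \<subset> T \<longrightarrow> colorable adj sg R)"
    using assms
  proof (induction "card S" arbitrary: S rule: less_induct)
    case less
    show ?case
    proof (cases "\<exists>R. R \<subset> S \<and> \<not> colorable adj sg R")
      case True
      then obtain R where R: "R \<subset> S" "\<not> colorable adj sg R" by blast
      then have "card R < card S" "finite R"
        using less.prems(1) psubset_card_mono finite_subset by blast+
      from less.hyps[OF this(1) this(2) R(2)] obtain T where
        T: "T \<subseteq> R" "\<not> colorable adj sg T" "\<forall>R. R \<subset> T \<longrightarrow> colorable adj sg R"
        by (elim exE conjE)
      then have "T \<subseteq> S" using R(1) by simp
      with T(2,3) show ?thesis by metis
    next
      case False
      then show ?thesis using less.prems by (intro exI[of _ S]) simp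
    qed
  qed
  then show thesis using that by metis
qed

lemma good_extend:
  assumes "good adj sg f S" "simple_signed adj sg" "v \<notin> S"
    and "\<And>a. a \<in> nb adj S v \<Longrightarrow> far (f a - c) = sg a v"
  shows "good adj sg (f(v := c)) (insert v S)"
  unfolding good_def
proof (intro ballI impI)
  fix a b assume ab: "a \<in> insert v S" "b \<in> insert v S" "adj a b"
  have ne: "a \<noteq> b" using ab(3) assms(2) unfolding simple_signed_def by blast
  show "far ((f(v := c)) a - (f(v := c)) b) = sg a b"
  proof (cases "a = v \<or> b = v")
    case True
    then show ?thesis using ab ne assms(2,4) far_minus_commute
      by (auto simp: nb_def simple_signed_def)
  next
    case False
    then show ?thesis using ab assms(1) unfolding good_def by auto
  qed
qed

section \<open>Contracting a coloured subgraph\<close>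

lemma far_offset: "far (d + (if p then 3 else 0) - (if q then 3 else 0)) \<longleftrightarrow> far d \<noteq> (p \<noteq> q)"
  using far_add_3[of d] far_add_3[of "d - 3"] by auto

text \<open>Colours in the same class modulo 3 are equal or antipodal modulo 6, and
  \<open>far\<close> tells which.\<close>

lemma mod_3_offset:
  assumes "(a :: int) mod 3 = b mod 3"
  shows "a mod 6 = (b + (if far (a - b) then 3 else 0)) mod 6"
proof -
  have "3 dvd a - b" using assms by (simp add: mod_eq_dvd_iff)
  then obtain k where k: "a = b + 3 * k" by (metis dvdE add.commute diff_add_cancel)
  show ?thesis
  proof (cases "even k")
    case True
    then obtain j where "k = 2 * j" by blast
    then show ?thesis using k by (simp add: far_def)
  next
    case False
    then obtain j where "k = 2 * j + 1" by (rule oddE)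
    then have "a = b + 3 + 6 * j" using k by simp
    then show ?thesis by (simp add: far_def)
  qed
qed

text \<open>Each colour class of S modulo 3 shrinks to one representative, after switching the
  vertices antipodal to it, and a colouring of the smaller graph pulls back to V. By
  \<open>one\<close> no two edges leaving S merge, so no digon arises. The final bound subtracts 3
  because the part of T inside X has potential at least 3.\<close>

lemma contraction:
  assumes fin: "finite V" and ss: "simple_signed adj sg" and nc: "\<not> colorable adj sg V"
    and SV: "S \<subseteq> V" and fS: "good adj sg f S"
    and one: "\<And>t. t \<in> V - S \<Longrightarrow> card (nb adj S t) \<le> 1"
  obtains adj' sg' X where
    "simple_signed adj' sg'" "X \<subseteq> S" "card X \<le> 3" "\<not> colorable adj' sg' ((V - S) \<union> X)"
    "\<And>T. T \<subseteq> V - S \<Longrightarrow> colorable adj sg T \<Longrightarrow> colorable adj' sg' T"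
    "\<And>T. T \<subseteq> (V - S) \<union> X \<Longrightarrow> T \<inter> X \<noteq> {} \<Longrightarrow>
       pot adj ((T - X) \<union> S) \<le> pot adj' T + pot adj S - 3"
proof -
  have sym: "adj u v = adj v u" "sg u v = sg v u" and irr: "\<not> adj v v" for u v
    using ss unfolding simple_signed_def by blast+
  have finS: "finite S" using fin SV finite_subset by blast
  define rep where "rep v = (SOME r. r \<in> S \<and> f r mod 3 = f v mod 3)" for v
  have rep: "rep v \<in> S" "f (rep v) mod 3 = f v mod 3" if "v \<in> S" for v
    using someI[of "\<lambda>r. r \<in> S \<and> f r mod 3 = f v mod 3" v] that unfolding rep_def by auto
  have rep_eq: "rep u = rep v" if "f u mod 3 = f v mod 3" for u v
    using that unfolding rep_def by simp
  define X where "X = rep ` S"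
  have XS: "X \<subseteq> S" using rep unfolding X_def by blast
  have repX: "rep x = x" if x: "x \<in> X" for x
  proof -
    obtain v where v: "v \<in> S" "x = rep v" using x unfolding X_def by blast
    show ?thesis using rep_eq[OF rep(2)[OF v(1)]] v by simp
  qed
  have "inj_on (\<lambda>x. f x mod 3) X" by (intro inj_onI) (metis rep_eq repX)
  moreover have "(\<lambda>x. f x mod 3) ` X \<subseteq> {0, 1, 2}"
  proof
    fix y assume "y \<in> (\<lambda>x. f x mod 3) ` X"
    then obtain x where "y = f x mod 3" by blast
    then have "0 \<le> y" "y < 3" by simp_all
    then show "y \<in> {0, 1, 2}" by auto
  qed
  ultimately have X3: "card X \<le> 3"
    using card_inj_on_le[of "\<lambda>x. f x mod 3" X "{0, 1, 2}"] by simp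

  define \<phi> where "\<phi> v = (if v \<in> S then rep v else v)" for v
  \<comment> \<open>Q marks the vertices of S whose colour is antipodal to that of their
    representative; these are switched before the identification.\<close>
  define Q where "Q v \<longleftrightarrow> v \<in> S \<and> far (f v - f (rep v))" for v
  \<comment> \<open>All pairs in X become adjacent, with the sign shown by \<open>f\<close>. So
    every colouring of the new graph repeats on X the pattern of far and near pairs of
    \<open>f\<close>, even if its colours differ.\<close>
  define adj' where "adj' a b \<longleftrightarrow> a \<noteq> b \<and>
      ((a \<in> X \<and> b \<in> X) \<or> (\<exists>u\<in>V. \<exists>v\<in>V. \<phi> u = a \<and> \<phi> v = b \<and> adj u v))" for a b
  define sg' where "sg' a b \<longleftrightarrow> (if a \<in> X \<and> b \<in> X then far (f a - f b)
      else \<exists>u\<in>V. \<exists>v\<in>V. \<phi> u = a \<and> \<phi> v = b \<and> adj u v \<and> sg u v \<noteq> (Q u \<noteq> Q v))" for a b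
  have \<phi>S: "\<phi> v \<in> X" if "v \<in> S" for v using that unfolding \<phi>_def X_def by simp
  have \<phi>out: "v = a" if "\<phi> v = a" "a \<notin> S" for v a
    using that \<phi>S XS unfolding \<phi>_def by (metis subsetD)
  have \<phi>in: "v \<in> S" if "\<phi> v = a" "a \<in> S" for v a
    using that unfolding \<phi>_def by (metis)
  have uniq: "v = v'" if "adj a v" "adj a v'" "a \<in> V - S" "v \<in> S" "v' \<in> S" for a v v'
  proof -
    have "v \<in> nb adj S a" "v' \<in> nb adj S a" "finite (nb adj S a)"
      using that finS unfolding nb_def by auto
    then show ?thesis using one[OF that(3)] by (auto simp: card_le_Suc0_iff_eq)
  qed
  have ss': "simple_signed adj' sg'"
    unfolding simple_signed_def
  proof (intro conjI allI)
    fix a b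
    show "adj' a b = adj' b a" unfolding adj'_def using sym by blast
    show "\<not> adj' a a" unfolding adj'_def by blast
    have "sg' a b \<Longrightarrow> sg' b a" for a b
      unfolding sg'_def using far_minus_commute[of "f a" "f b"]
      by (simp split: if_splits) (metis sym)
    then show "sg' a b = sg' b a" by blast
  qed
  have mixed: "adj' (\<phi> u) (\<phi> v) \<and> sg' (\<phi> u) (\<phi> v) = (sg u v \<noteq> (Q u \<noteq> Q v))"
    if uv: "u \<in> V" "v \<in> V" "adj u v" "u \<notin> S \<or> v \<notin> S" for u v
  proof
    have ne: "\<phi> u \<noteq> \<phi> v" using uv irr \<phi>out \<phi>in by metis
    then show "adj' (\<phi> u) (\<phi> v)" using uv unfolding adj'_def by blast
    have nX: "\<not> (\<phi> u \<in> X \<and> \<phi> v \<in> X)" using uv(4) XS unfolding \<phi>_def by auto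
    \<comment> \<open>A contracted edge with an end outside S has a unique preimage, so its sign in
      \<open>sg'\<close> is unambiguous.\<close>
    have un: "u' = u \<and> v' = v"
      if "u' \<in> V" "v' \<in> V" "\<phi> u' = \<phi> u" "\<phi> v' = \<phi> v" "adj u' v'" for u' v'
    proof (cases "u \<in> S")
      case True
      then have v: "v \<notin> S" using uv by blast
      then have v': "v' = v" using that \<phi>out[of v' v] unfolding \<phi>_def by auto
      have "u' \<in> S" using True that \<phi>S XS \<phi>in by (metis subsetD)
      then show ?thesis using uniq[of v u' u] True v v' that uv sym by blast
    next
      case False
      then have u': "u' = u" using that \<phi>out[of u' u] unfolding \<phi>_def by auto
      show ?thesis
      proof (cases "v \<in> S")
        case True
        have "v' \<in> S" using True that \<phi>S XS \<phi>in by (metis subsetD)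
        then show ?thesis using uniq[of u v' v] True False u' that uv by blast
      next
        case False
        then show ?thesis using u' that \<phi>out[of v' v] unfolding \<phi>_def by auto
      qed
    qed
    show "sg' (\<phi> u) (\<phi> v) = (sg u v \<noteq> (Q u \<noteq> Q v))"
      unfolding sg'_def if_not_P[OF nX] using un uv by blast
  qed
  have nc': "\<not> colorable adj' sg' ((V - S) \<union> X)"
  proof
    assume "colorable adj' sg' ((V - S) \<union> X)"
    then obtain g where g: "good adj' sg' g ((V - S) \<union> X)" unfolding colorable_def by blast
    have \<phi>V: "\<phi> v \<in> (V - S) \<union> X" if "v \<in> V" for v using that \<phi>S unfolding \<phi>_def by auto
    \<comment> \<open>Every vertex takes the colour of its representative, and the switching is
      undone where Q holds.\<close>
    define F where "F v = g (\<phi> v) + (if Q v then 3 else 0)" for v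
    have "far (F u - F v) = sg u v" if uv: "u \<in> V" "v \<in> V" "adj u v" for u v
    proof -
      have F: "far (F u - F v) = (far (g (\<phi> u) - g (\<phi> v)) \<noteq> (Q u \<noteq> Q v))"
        using far_offset[of "g (\<phi> u) - g (\<phi> v)" "Q u" "Q v"] unfolding F_def
        by (simp add: algebra_simps)
      show ?thesis
      proof (cases "u \<in> S \<and> v \<in> S")
        case True
        have "far (g (\<phi> u) - g (\<phi> v)) = far (f (rep u) - f (rep v))"
        proof (cases "rep u = rep v")
          case True
          then show ?thesis using \<open>u \<in> S \<and> v \<in> S\<close> unfolding \<phi>_def by simp
        next
          case False
          then have "adj' (\<phi> u) (\<phi> v)" "sg' (\<phi> u) (\<phi> v) = far (f (rep u) - f (rep v))"
            using True unfolding adj'_def sg'_def \<phi>_def X_def by auto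
          then show ?thesis using g \<phi>V uv unfolding good_def by blast
        qed
        moreover have "(f u - f v) mod 6
            = (f (rep u) - f (rep v) + (if Q u then 3 else 0) - (if Q v then 3 else 0)) mod 6"
        proof -
          have "f w mod 6 = (f (rep w) + (if Q w then 3 else 0)) mod 6" if "w \<in> S" for w
            using mod_3_offset[of "f w" "f (rep w)"] rep(2)[OF that] that unfolding Q_def by simp
          then have "(f u - f v) mod 6 = (f (rep u) + (if Q u then 3 else 0)
              - (f (rep v) + (if Q v then 3 else 0))) mod 6"
            using True by (intro mod_diff_cong) auto
          then show ?thesis by (simp add: algebra_simps)
        qed
        then have "far (f u - f v) = (far (f (rep u) - f (rep v)) \<noteq> (Q u \<noteq> Q v))"
          using far_offset far_cong by metis
        moreover have "far (f u - f v) = sg u v" using fS True uv unfolding good_def by blast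
        ultimately show ?thesis using F by blast
      next
        case False
        then show ?thesis using F mixed[of u v] g \<phi>V uv unfolding good_def by blast
      qed
    qed
    then have "good adj sg F V" unfolding good_def by blast
    then show False using nc unfolding colorable_def by blast
  qed
  have outer: "colorable adj' sg' T" if T: "T \<subseteq> V - S" "colorable adj sg T" for T
  proof -
    obtain g where g: "good adj sg g T" using T unfolding colorable_def by blast
    have "far (g a - g b) = sg' a b" if ab: "a \<in> T" "b \<in> T" "adj' a b" for a b
    proof -
      have out: "a \<notin> S" "b \<notin> S" "a \<in> V" "b \<in> V" using T ab by auto
      then have "a \<notin> X" using XS by blast
      then obtain u v where uv: "\<phi> u = a" "\<phi> v = b" "adj u v"
        using ab(3) unfolding adj'_def by blast
      then have "adj a b" using \<phi>out[OF uv(1) out(1)] \<phi>out[OF uv(2) out(2)] by simp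
      moreover have "sg' a b = sg a b"
        using mixed[of a b] out \<open>adj a b\<close> unfolding \<phi>_def Q_def by simp
      ultimately show ?thesis using g ab unfolding good_def by simp
    qed
    then show ?thesis unfolding colorable_def good_def by blast
  qed
  \<comment> \<open>Edges within \<open>T - X\<close> are old edges, and those from there into X
    stem from distinct edges into S. Replacing \<open>T \<inter> X\<close> by S therefore costs at
    most the difference of their potentials.\<close>
  have lift: "pot adj ((T - X) \<union> S) \<le> pot adj' T + pot adj S - 3"
    if T: "T \<subseteq> (V - S) \<union> X" "T \<inter> X \<noteq> {}" for T
  proof -
    define A where "A = T - X"
    define Y where "Y = T \<inter> X"
    have A: "A \<subseteq> V - S" "finite A" "A \<inter> S = {}" "A \<inter> Y = {}" and Y: "Y \<subseteq> X" "finite Y" "Y \<noteq> {}"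
      and TAY: "T = A \<union> Y"
      using T fin finite_subset[OF XS finS] unfolding A_def Y_def by (auto intro: finite_subset)
    have sym': "adj' u v = adj' v u" for u v using ss' unfolding simple_signed_def by blast
    have "links adj' A A \<le> links adj A A"
      unfolding links_def
    proof (intro sum_mono card_mono)
      fix a assume "a \<in> A"
      show "nb adj' A a \<subseteq> nb adj A a"
      proof
        fix b assume b: "b \<in> nb adj' A a"
        then have "b \<in> A" "b \<notin> S" "a \<notin> S" "a \<notin> X"
          using A(3) \<open>a \<in> A\<close> XS unfolding nb_def by auto
        moreover obtain u v where uv: "\<phi> u = a" "\<phi> v = b" "adj u v"
          using b \<open>a \<notin> X\<close> unfolding nb_def adj'_def by blast
        ultimately show "b \<in> nb adj A a"
          using \<phi>out[OF uv(1)] \<phi>out[OF uv(2)] unfolding nb_def by simp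
      qed
    qed (use A in \<open>simp add: nb_def\<close>)
    then have pA: "pot adj A \<le> pot adj' A" unfolding pot_def by simp
    have "links adj' A Y \<le> links adj A S"
      unfolding links_def
    proof (intro sum_mono)
      fix a assume a: "a \<in> A"
      have fn: "finite (nb adj S a)" using finS unfolding nb_def by simp
      have "nb adj' Y a \<subseteq> rep ` nb adj S a"
      proof
        fix y assume y: "y \<in> nb adj' Y a"
        then have "y \<in> X" "a \<notin> X" using Y A a XS unfolding nb_def by auto
        then obtain u v where uv: "u \<in> V" "v \<in> V" "\<phi> u = a" "\<phi> v = y" "adj u v"
          using y unfolding nb_def adj'_def by blast
        have "u = a" using uv A a \<phi>out by blast
        moreover have "v \<in> S" using uv \<open>y \<in> X\<close> XS \<phi>in by blast
        ultimately show "y \<in> rep ` nb adj S a" using uv unfolding nb_def \<phi>_def by auto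
      qed
      then show "card (nb adj' Y a) \<le> card (nb adj S a)"
        using card_mono[of "rep ` nb adj S a"] card_image_le[OF fn, of rep] fn by (meson finite_imageI le_trans)
    qed
    then have pL: "int (links adj' A Y) \<le> int (links adj A S)" by simp
    have "pot adj' Y \<ge> int (card Y) * (4 - int (card Y))" using pot_ge[OF Y(2) ss'] .
    moreover have "card Y = 1 \<or> card Y = 2 \<or> card Y = 3"
    proof -
      have "card Y \<le> 3" using card_mono[of X Y] Y X3 finite_subset[OF XS finS] by linarith
      moreover have "card Y \<noteq> 0" using Y by simp
      ultimately show ?thesis by arith
    qed
    ultimately have pY: "pot adj' Y \<ge> 3" by auto
    have "pot adj' T = pot adj' A + pot adj' Y - 2 * int (links adj' A Y)"
      unfolding TAY using A Y sym' by (intro pot_Un) auto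
    moreover have "pot adj (A \<union> S) = pot adj A + pot adj S - 2 * int (links adj A S)"
      using A finS sym by (intro pot_Un) auto
    ultimately show ?thesis using pA pL pY unfolding A_def by linarith
  qed
  show thesis using that[OF ss' XS X3 nc' outer lift] .
qed

section \<open>The minimal counterexample: potential gap and imposed edges\<close>

locale minimal_counterexample =
  fixes V :: "'v set" and adj sg :: "'v \<Rightarrow> 'v \<Rightarrow> bool"
  assumes fin: "finite V"
    and ss: "simple_signed adj sg"
    and noncol: "\<not> colorable adj sg V"
    and crit: "S \<subset> V \<Longrightarrow> colorable adj sg S"
    and big: "pot adj V \<ge> 2"
    and IH: "card S < card V \<Longrightarrow> finite S \<Longrightarrow> simple_signed adj' sg' \<Longrightarrow>
      \<not> colorable adj' sg' S \<Longrightarrow> (\<And>T. T \<subset> S \<Longrightarrow> colorable adj' sg' T) \<Longrightarrow> pot adj' S \<le> 1"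
begin

lemma adj_commute: "adj u v = adj v u"
  and adj_irrefl [simp]: "\<not> adj v v"
  and sg_commute: "sg u v = sg v u"
  using ss unfolding simple_signed_def by blast+

lemma fin_sub: "S \<subseteq> V \<Longrightarrow> finite S"
  using fin finite_subset by blast

lemma smaller_noncol:
  fixes S :: "'v set"
  assumes "card S < card V" "finite S" "simple_signed adj' sg'" "\<not> colorable adj' sg' S"
  obtains T where "T \<subseteq> S" "\<not> colorable adj' sg' T" "pot adj' T \<le> 1"
proof -
  obtain T where T: "T \<subseteq> S" "\<not> colorable adj' sg' T" "\<And>R. R \<subset> T \<Longrightarrow> colorable adj' sg' R"
    using critical_subset[OF assms(2,4)] by metis
  have "card T < card V" "finite T" using T(1) assms card_mono[of S T] finite_subset by auto
  then have "pot adj' T \<le> 1" using IH[of T adj' sg'] assms(3) T(2,3) by simp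
  then show thesis using that[OF T(1,2)] by simp
qed

text \<open>Contract \<open>S\<close> to at most three vertices, one per colour class. These have potential at least 3,
  so a noncolourable piece of the contracted graph, pulled back, loses at least 2 against \<open>S\<close>.\<close>

lemma enlarge:
  assumes "S \<subset> V" "card S \<ge> 4"
  obtains t where "t \<in> V - S" "card (nb adj S t) \<ge> 2"
  | S' where "S \<subset> S'" "S' \<subseteq> V" "pot adj S' \<le> pot adj S - 2"
proof (cases "\<exists>t\<in>V - S. card (nb adj S t) \<ge> 2")
  case True
  then show thesis using that(1) by blast
next
  case False
  then have one: "card (nb adj S t) \<le> 1" if "t \<in> V - S" for t using that by force
  obtain f where f: "good adj sg f S" using crit[OF assms(1)] unfolding colorable_def by blast
  have SV: "S \<subseteq> V" using assms by blast
  obtain adj' sg' X where c: "simple_signed adj' sg'" "X \<subseteq> S" "card X \<le> 3"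
    "\<not> colorable adj' sg' ((V - S) \<union> X)"
    and outer: "\<And>T. T \<subseteq> V - S \<Longrightarrow> colorable adj sg T \<Longrightarrow> colorable adj' sg' T"
    and lift: "\<And>T. T \<subseteq> (V - S) \<union> X \<Longrightarrow> T \<inter> X \<noteq> {} \<Longrightarrow>
       pot adj ((T - X) \<union> S) \<le> pot adj' T + pot adj S - 3"
    using contraction[OF fin ss noncol SV f one] by metis
  have fS: "finite S" "finite X" using fin_sub[OF SV] c(2) finite_subset by blast+
  have "card ((V - S) \<union> X) = card V - card S + card X"
    using fS SV c(2) fin by (subst card_Un_disjoint) (auto simp: card_Diff_subset)
  moreover have "card S \<le> card V" using SV fin card_mono by blast
  ultimately have lt: "card ((V - S) \<union> X) < card V" using c(3) assms(2) by linarith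
  have "finite ((V - S) \<union> X)" using fin fS by simp
  then obtain T where T: "T \<subseteq> (V - S) \<union> X" "\<not> colorable adj' sg' T" "pot adj' T \<le> 1"
    using smaller_noncol[OF lt _ c(1,4)] by blast
  have TX: "T \<inter> X \<noteq> {}"
  proof
    assume "T \<inter> X = {}"
    then have "T \<subseteq> V - S" using T by blast
    moreover have "S \<noteq> {}" using assms(2) by auto
    then have "V - S \<subset> V" using assms(1) by blast
    ultimately have "colorable adj sg T" by (intro crit) auto
    then show False using outer T \<open>T \<subseteq> V - S\<close> by blast
  qed
  have "pot adj ((T - X) \<union> S) \<le> pot adj S - 2" using lift[OF T(1) TX] T(3) by simp
  \<comment> \<open>A piece inside X would have at most three vertices and thus potential at least
    3. So the pulled-back set is strictly larger than S.\<close>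
  moreover have "T - X \<noteq> {}"
  proof
    assume "T - X = {}"
    then have le: "3 \<le> pot adj' T" 
    proof -
      have "T \<subseteq> X" using \<open>T - X = {}\<close> by blast
      then have ft: "finite T" "card T \<le> 3" using fS c(3) card_mono[of X T] finite_subset by auto
      moreover have "card T \<noteq> 0" using TX ft by auto
      ultimately have "card T = 1 \<or> card T = 2 \<or> card T = 3" by arith
      then show ?thesis using pot_ge[OF ft(1) c(1)] by auto
    qed
    then show False using T(3) by simp
  qed
  ultimately show thesis using that(2)[of "(T - X) \<union> S"] T(1) c(2) SV by blast
qed

text \<open>S is enlarged until V is reached. Absorbing a vertex with two neighbours contributes at
  most 3 - 4 = -1, a contraction at most -2. Proper supersets have at least 3, so a step to one of
  them gives 4. For V only 2 is known: a step straight to V gives 4 by contraction and 3 by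
  absorption.\<close>

lemma pot_proper:
  assumes "S \<subset> V" "card S \<ge> 4"
  shows "pot adj S \<ge> 4 \<or> (pot adj S = 3 \<and> (\<exists>t. t \<notin> S \<and> V = insert t S))"
  using assms
proof (induction "card (V - S)" arbitrary: S rule: less_induct)
  case less
  have "finite S" using less.prems fin_sub by blast
  have step: ?case if S': "S \<subset> S'" "S' \<subseteq> V" "pot adj S' \<le> pot adj S - 1"
    "V = S' \<Longrightarrow> pot adj S' \<le> pot adj S - 2 \<or> (\<exists>t. t \<notin> S \<and> S' = insert t S)" for S'
  proof (cases "S' = V")
    case True
    then show ?thesis using S' big by auto
  next
    case False
    have "card (V - S') < card (V - S)" using S' fin by (intro psubset_card_mono) auto
    moreover have "card S' \<ge> 4" using less.prems S' card_mono[of S' S] fin_sub[of S'] by auto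
    ultimately have "pot adj S' \<ge> 3" using less.hyps[of S'] False S' by fastforce
    then show ?thesis using S' by linarith
  qed
  from less.prems show ?case
  proof (cases rule: enlarge)
    case (1 t)
    then have t: "t \<notin> S" "t \<in> V" by auto
    have "pot adj (insert t S) \<le> pot adj S - 1"
      using pot_insert[OF \<open>finite S\<close> t(1) ss] 1 by linarith
    then show ?thesis using step[of "insert t S"] t less.prems by blast
  next
    case (2 S')
    then show ?thesis using step[of S'] by simp
  qed
qed

lemma pot_ge_3: "S \<subset> V \<Longrightarrow> card S \<ge> 4 \<Longrightarrow> pot adj S \<ge> 3"
  using pot_proper[of S] by auto

lemma pot_ge_4:
  assumes "S \<subseteq> V" "card S \<ge> 4" "a \<in> V - S" "b \<in> V - S" "a \<noteq> b"
  shows "pot adj S \<ge> 4"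
  using pot_proper[of S] assms by blast

text \<open>If the edge destroyed colourability, a noncolourable piece T would contain both ends and
  have potential at most 1 with the edge, so at most 3 without it. But T misses \<open>p\<close> and
  \<open>q\<close>, and \<open>pot_ge_4\<close> applies. The assumption \<open>sign\<close> keeps
  the edge from forming a digon.\<close>

lemma add_edge:
  assumes "S \<subseteq> V" "p \<in> V - S" "q \<in> V - S" "p \<noteq> q" "a \<in> S" "b \<in> S" "a \<noteq> b"
    and sign: "adj a b \<Longrightarrow> sg a b = \<sigma>"
  obtains f where "good adj sg f S" "far (f a - f b) = \<sigma>"
proof (cases "adj a b")
  case True
  have "S \<subset> V" using assms by blast
  then obtain f where "good adj sg f S" using crit unfolding colorable_def by blast
  then show thesis using that True sign assms unfolding good_def by blast
next
  case nadj: False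
  define adj' where "adj' u v \<longleftrightarrow> adj u v \<or> {u, v} = {a, b}" for u v
  define sg' where "sg' u v = (if {u, v} = {a, b} then \<sigma> else sg u v)" for u v
  have ss': "simple_signed adj' sg'"
    using ss \<open>a \<noteq> b\<close> unfolding simple_signed_def adj'_def sg'_def by (auto simp: doubleton_eq_iff)
  have fS: "finite S" using fin_sub assms by blast
  have "colorable adj' sg' S"
  proof (rule ccontr)
    assume nc: "\<not> colorable adj' sg' S"
    have "S \<subset> V" using assms by blast
    then have "card S < card V" using fin psubset_card_mono by blast
    from smaller_noncol[OF this fS ss' nc] obtain T where
      T: "T \<subseteq> S" "\<not> colorable adj' sg' T" "pot adj' T \<le> 1" by blast
    have fT: "finite T" using T(1) fS finite_subset by blast
    have ab: "a \<in> T" "b \<in> T"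
    proof -
      have "colorable adj sg T" using crit[of T] T \<open>S \<subset> V\<close> by blast
      then obtain f where f: "good adj sg f T" unfolding colorable_def by blast
      have "good adj' sg' f T" if out: "a \<notin> T \<or> b \<notin> T"
        unfolding good_def
      proof (intro ballI impI)
        fix u v assume uv: "u \<in> T" "v \<in> T" "adj' u v"
        then have ne: "{u, v} \<noteq> {a, b}" using out by (auto simp: doubleton_eq_iff)
        then have "adj u v" using uv unfolding adj'_def by simp
        then show "far (f u - f v) = sg' u v" using f uv ne unfolding good_def sg'_def by simp
      qed
      then show "a \<in> T" "b \<in> T" using T unfolding colorable_def by blast+
    qed
    have T4: "card T \<ge> 4"
    proof (rule ccontr)
      assume "\<not> card T \<ge> 4"
      moreover have "card T \<noteq> 0" using ab fT by auto
      ultimately have "card T = 1 \<or> card T = 2 \<or> card T = 3" by arith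
      then show False using pot_ge[OF fT ss'] T(3) by auto
    qed
    have "links adj' T T = links adj T T + 2"
    proof -
      define R where "R = T - {a, b}"
      have R: "T = insert a (insert b R)" "a \<notin> R" "b \<notin> R" "finite R" using ab fT unfolding R_def by auto
      have "nb adj' T a = insert b (nb adj T a)" "nb adj' T b = insert a (nb adj T b)"
        using ab \<open>a \<noteq> b\<close> unfolding nb_def adj'_def by (auto simp: doubleton_eq_iff)
      moreover have "b \<notin> nb adj T a" "a \<notin> nb adj T b"
        using nadj adj_commute unfolding nb_def by auto
      moreover have "finite (nb adj T v)" for v using fT unfolding nb_def by simp
      ultimately have c: "card (nb adj' T a) = Suc (card (nb adj T a))"
        "card (nb adj' T b) = Suc (card (nb adj T b))" by simp_all
      have "nb adj' T v = nb adj T v" if "v \<in> R" for v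
        using that unfolding R_def nb_def adj'_def by (auto simp: doubleton_eq_iff)
      then have r: "(\<Sum>v\<in>R. card (nb adj' T v)) = (\<Sum>v\<in>R. card (nb adj T v))" by simp
      have "links X T T = card (nb X T a) + (card (nb X T b) + (\<Sum>v\<in>R. card (nb X T v)))" for X
        unfolding links_def using R(2-4) \<open>a \<noteq> b\<close> 
        by (subst (2) R(1)) simp
      then show ?thesis using c r by simp
    qed
    then have "pot adj T \<le> 3" using T(3) unfolding pot_def by simp
    then show False using pot_ge_4[of T p q] T(1) assms(1-4) T4 by auto
  qed
  then obtain f where f: "good adj' sg' f S" unfolding colorable_def by blast
  have "good adj sg f S"
    unfolding good_def
  proof (intro ballI impI)
    fix u v assume uv: "u \<in> S" "v \<in> S" "adj u v"
    then have ne: "{u, v} \<noteq> {a, b}" using nadj adj_commute by (auto simp: doubleton_eq_iff)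
    then show "far (f u - f v) = sg u v"
      using f uv unfolding good_def adj'_def sg'_def by simp
  qed
  moreover have "far (f a - f b) = \<sigma>" using f assms unfolding good_def adj'_def sg'_def by simp
  ultimately show thesis using that by blast
qed

end

section \<open>Vertices of degree two\<close>

text \<open>A neighbour of colour \<open>a\<close> along an edge of sign \<open>\<sigma>\<close> leaves exactly the three residues around
  \<open>center a \<sigma>\<close> available.\<close>

definition center :: "int \<Rightarrow> bool \<Rightarrow> int" where
  "center a \<sigma> = a + (if \<sigma> then 3 else 0)"

lemma far_eq_iff: "far (a - c) = \<sigma> \<longleftrightarrow> \<not> far (c - center a \<sigma>)"
  using far_offset[of "c - a" False \<sigma>] far_minus_commute[of a c]
  unfolding center_def by (auto simp: algebra_simps)

lemma far_center_diff: "far (center a \<sigma> - center b \<tau>) \<longleftrightarrow> far (a - b) \<noteq> (\<sigma> \<noteq> \<tau>)"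
  using far_offset[of "a - b" \<sigma> \<tau>] unfolding center_def by (simp add: algebra_simps)

lemma far_add: "far (d + k) \<longleftrightarrow> (d mod 6 + k) mod 6 \<in> {2, 3, 4}"
  unfolding far_def by (simp add: mod_add_left_eq)

text \<open>Two intervals of three consecutive residues are disjoint only if their centres are
  antipodal.\<close>

lemma near_both:
  assumes "(\<alpha> - \<beta>) mod 6 \<noteq> 3"
  obtains c where "\<not> far (c - \<alpha>)" "\<not> far (c - \<beta>)"
proof -
  define d where "d = \<alpha> - \<beta>"
  have "\<exists>i\<in>{-1, 0, 1}. \<not> far (d + i)"
  proof -
    have "\<forall>r\<in>{0, 1, 2, 3, 4, 5 :: int}. r \<noteq> 3 \<longrightarrow> (\<exists>i\<in>{-1, 0, 1}. (r + i) mod 6 \<notin> {2, 3, 4})"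
      by code_simp
    from bspec[OF this mod_6_cases[of d]] show ?thesis
      using assms unfolding d_def[symmetric] far_add by simp
  qed
  moreover have "\<not> far i" if "i \<in> {-1, 0, 1}" for i
  proof -
    have "\<forall>i\<in>{-1, 0, 1 :: int}. i mod 6 \<notin> {2, 3, 4}" by simp
    then show ?thesis using that unfolding far_def by blast
  qed
  ultimately obtain i where "\<not> far i" "\<not> far (d + i)" by blast
  then show thesis using that[of "\<beta> + i"] that[of "\<alpha> + i"] unfolding d_def by (simp add: algebra_simps)
qed

lemma common_color:
  assumes "(a - b) mod 6 \<noteq> (if \<sigma> = \<tau> then 3 else 0)"
  obtains c where "far (a - c) = \<sigma>" "far (b - c) = \<tau>"
proof -
  have "(center a \<sigma> - center b \<tau>) mod 6 \<noteq> 3"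
  proof -
    define d where "d = a - b"
    have "center a \<sigma> - center b \<tau> = d + ((if \<sigma> then 3 else 0) - (if \<tau> then 3 else 0))"
      unfolding center_def d_def by simp
    then have "(center a \<sigma> - center b \<tau>) mod 6
        = (d mod 6 + ((if \<sigma> then 3 else 0) - (if \<tau> then 3 else 0))) mod 6"
      by (simp only: mod_add_left_eq)
    moreover have "\<forall>r\<in>{0, 1, 2, 3, 4, 5 :: int}. r \<noteq> (if \<sigma> = \<tau> then 3 else 0) \<longrightarrow>
        (r + ((if \<sigma> then 3 else 0) - (if \<tau> then 3 else 0))) mod 6 \<noteq> 3"
      by (cases \<sigma>; cases \<tau>) simp_all
    ultimately show ?thesis using assms mod_6_cases[of d] unfolding d_def[symmetric] by metis
  qed
  then obtain c where "\<not> far (c - center a \<sigma>)" "\<not> far (c - center b \<tau>)"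
    using near_both by blast
  then show thesis using that[of c] far_eq_iff by blast
qed

text \<open>The differences of elements from two intervals of three residues cover five of the six
  residues, hence meet both the three near and the three far ones.\<close>

lemma path_colors:
  obtains c c' where "far (a - c) = \<sigma>" "far (b - c') = \<tau>" "far (c - c') = \<rho>"
proof -
  define d where "d = center a \<sigma> - center b \<tau>"
  have "\<exists>i j. \<not> far i \<and> \<not> far j \<and> far (d + i - j) = \<rho>"
  proof -
    have "\<forall>\<rho>. \<forall>r\<in>{0, 1, 2, 3, 4, 5 :: int}. \<exists>i\<in>{-1, 0, 1}. \<exists>j\<in>{-1, 0, 1}.
        ((r + (i - j)) mod 6 \<in> {2, 3, 4}) = \<rho>"
      by code_simp
    from bspec[OF spec[OF this, of \<rho>] mod_6_cases[of d]] obtain i j where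
      ij: "i \<in> {-1, 0, 1}" "j \<in> {-1, 0, 1}" "far (d + (i - j)) = \<rho>"
      unfolding far_add by (elim bexE)
    have "\<forall>i\<in>{-1, 0, 1 :: int}. \<not> far i" unfolding far_def by simp
    from bspec[OF this ij(1)] bspec[OF this ij(2)] have "\<not> far i" "\<not> far j" .
    then show ?thesis using ij(3) by (metis add_diff_eq)
  qed
  then obtain i j where ij: "\<not> far i" "\<not> far j" "far (d + i - j) = \<rho>" by blast
  show thesis
    using that[of "center a \<sigma> + i" "center b \<tau> + j"] ij far_eq_iff unfolding d_def
    by (simp add: algebra_simps)
qed

lemma avoid_residues:
  assumes "finite I" "inj_on (\<lambda>x. x mod 6) I" "finite F" "card F < card (I :: int set)"
  obtains c where "c \<in> I" "\<And>x. x \<in> F \<Longrightarrow> c mod 6 \<noteq> x mod 6"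
proof -
  have "card ((\<lambda>x. x mod 6) ` F) < card ((\<lambda>x. x mod 6) ` I)"
    using assms card_image[OF assms(2)] card_image_le[OF assms(3), of "\<lambda>x. x mod 6"] by simp
  then have "\<not> (\<lambda>x. x mod 6) ` I \<subseteq> (\<lambda>x. x mod 6) ` F"
    using assms(3) card_mono[of "(\<lambda>x. x mod 6) ` F" "(\<lambda>x. x mod 6) ` I"] by fastforce
  then obtain c where "c \<in> I" "c mod 6 \<notin> (\<lambda>x. x mod 6) ` F" by blast
  then show thesis using that[of c] by blast
qed

lemma near_interval:
  fixes \<alpha> :: int
  shows "inj_on (\<lambda>x. x mod 6) {\<alpha> - 1, \<alpha>, \<alpha> + 1}" "card {\<alpha> - 1, \<alpha>, \<alpha> + 1} = 3"
    "c \<in> {\<alpha> - 1, \<alpha>, \<alpha> + 1} \<Longrightarrow> \<not> far (c - \<alpha>)"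
  by (auto simp: inj_on_def far_def mod_eq_dvd_iff)

section \<open>Strong and weak neighbours in the minimal counterexample\<close>

context minimal_counterexample
begin

abbreviation "N \<equiv> nb adj V"

definition "D2 = {v \<in> V. card (N v) = 2}"

text \<open>A neighbour of degree two acts as a weak edge: with signs fixed, it forbids a single residue
  (\<open>forb f v u\<close> below), determined by the colour of its other neighbour, whereas a strong
  neighbour forbids three. Correspondingly \<open>excess\<close> is the charge \<open>6 - 2 d(v)\<close> after every
  vertex of degree two has given 1 to both its neighbours.\<close>

definition "strong v = N v - D2"

definition "weak v = N v \<inter> D2"

definition "excess v = 6 - 2 * int (card (strong v)) - int (card (weak v))"

definition oth :: "'v \<Rightarrow> 'v \<Rightarrow> 'v" where
  "oth u v = (THE w. w \<in> N u \<and> w \<noteq> v)"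

definition forb :: "('v \<Rightarrow> int) \<Rightarrow> 'v \<Rightarrow> 'v \<Rightarrow> int" where
  "forb f v u = center (f (oth u v)) (sg u v = sg u (oth u v))"

lemma in_N: "w \<in> N v \<longleftrightarrow> w \<in> V \<and> adj v w"
  unfolding nb_def by blast

lemma fin_N [simp]: "finite (N v)"
  unfolding nb_def using fin by simp

lemma fin_strong [simp]: "finite (strong v)" and fin_weak [simp]: "finite (weak v)"
  unfolding strong_def weak_def by simp_all

lemma D2_sub: "D2 \<subseteq> V"
  unfolding D2_def by blast

lemma fin_D2 [simp]: "finite D2"
  using fin_sub[OF D2_sub] .

lemma card_N: "card (N v) = card (strong v) + card (weak v)"
  unfolding strong_def weak_def
  by (subst card_Un_disjoint[symmetric]) (auto intro: arg_cong[where f = card])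

lemma strongD:
  assumes "x \<in> strong v"
  shows "x \<in> V - D2" "adj v x" "adj x v" "x \<noteq> v"
  using assms adj_commute unfolding strong_def nb_def by auto

lemma not_good_V: "\<not> good adj sg g V"
  using noncol unfolding colorable_def by blast

lemma colorable_proper:
  assumes "S \<subset> V"
  obtains f where "good adj sg f S"
  using crit[OF assms] unfolding colorable_def by blast

lemma deg_ge_2:
  assumes "v \<in> V"
  shows "card (N v) \<ge> 2"
proof (rule ccontr)
  assume "\<not> card (N v) \<ge> 2"
  then have "card (N v) \<le> Suc 0" by simp
  then have eq: "a = b" if "a \<in> N v" "b \<in> N v" for a b
    using that fin_N card_le_Suc0_iff_eq by metis
  obtain f where f: "good adj sg f (V - {v})" using colorable_proper[of "V - {v}"] assms by blast
  have "\<exists>c. \<forall>a\<in>N v. far (f a - c) = sg a v"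
  proof (cases "N v = {}")
    case False
    then obtain a where "a \<in> N v" by blast
    moreover have "far (f a - center (f a) (sg a v)) = sg a v" using far_eq_iff by simp
    ultimately show ?thesis using eq by metis
  qed simp
  then obtain c where "\<forall>a\<in>N v. far (f a - c) = sg a v" by blast
  then have "good adj sg (f(v := c)) (insert v (V - {v}))"
    by (intro good_extend[OF f ss]) (auto simp: nb_def)
  then show False using not_good_V assms by (simp add: insert_absorb)
qed

lemma D2_nbs:
  assumes "u \<in> D2" "v \<in> N u"
  shows "N u = {v, oth u v}" "oth u v \<noteq> v" "oth u v \<in> V"
proof -
  obtain a b where ab: "N u = {a, b}" "a \<noteq> b" 
    using assms(1) unfolding D2_def by (auto simp: card_2_iff)
  have "\<exists>!w. w \<in> N u \<and> w \<noteq> v" using ab assms(2) by auto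
  from theI'[OF this] have o: "oth u v \<in> N u" "oth u v \<noteq> v" unfolding oth_def by auto
  then show "N u = {v, oth u v}" "oth u v \<noteq> v" "oth u v \<in> V" using ab assms(2) in_N by auto
qed

text \<open>With everything else coloured, the two vertices form a path between fixed colours, which
  \<open>path_colors\<close> always completes; its outer ends may coincide.\<close>

lemma D2_indep:
  assumes "u \<in> D2" "u' \<in> D2"
  shows "\<not> adj u u'"
proof
  assume a: "adj u u'"
  have V: "u \<in> V" "u' \<in> V" and ne: "u \<noteq> u'" using assms D2_sub a by auto
  define p q where "p = oth u u'" and "q = oth u' u"
  have p: "N u = {u', p}" "p \<noteq> u'" and q: "N u' = {u, q}" "q \<noteq> u"
    using D2_nbs[of u u'] D2_nbs[of u' u] assms V a adj_commute in_N unfolding p_def q_def by auto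
  obtain f where f: "good adj sg f (V - {u, u'})" using colorable_proper[of "V - {u, u'}"] V by blast
  obtain c c' where c: "far (f p - c) = sg p u" "far (f q - c') = sg q u'" "far (c - c') = sg u u'"
    by (rule path_colors)
  have "p \<in> N u" "q \<in> N u'" using p q by auto
  then have pq: "p \<noteq> u" "q \<noteq> u'" using in_N by auto
  have "good adj sg (f(u := c)) (insert u (V - {u, u'}))"
  proof (rule good_extend[OF f ss])
    fix a assume "a \<in> nb adj (V - {u, u'}) u"
    then have "a \<in> N u" "a \<noteq> u'" unfolding nb_def by auto
    then show "far (f a - c) = sg a u" using p c by simp
  qed simp
  then have "good adj sg (f(u := c, u' := c')) (insert u' (insert u (V - {u, u'})))"
  proof (rule good_extend[OF _ ss])
    show "u' \<notin> insert u (V - {u, u'})" using ne by simp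
    fix a assume "a \<in> nb adj (insert u (V - {u, u'})) u'"
    then have "a \<in> N u'" using V unfolding nb_def by auto
    then show "far ((f(u := c)) a - c') = sg a u'" using q c by auto
  qed
  moreover have "insert u' (insert u (V - {u, u'})) = V" using V by blast
  ultimately show False using not_good_V by metis
qed

lemma weak_oth:
  assumes "v \<in> V - D2" "u \<in> weak v"
  shows "N u = {v, oth u v}" "oth u v \<noteq> v" "oth u v \<in> V - D2" "u \<in> D2" "adj u v" "adj v u"
    "adj u (oth u v)" "u \<in> V"
proof -
  have u: "u \<in> D2" "adj v u" "u \<in> V" using assms unfolding weak_def nb_def by auto
  then have "v \<in> N u" using assms adj_commute in_N by blast
  note n = D2_nbs[OF u(1) this]
  show "N u = {v, oth u v}" "oth u v \<noteq> v" "u \<in> D2" "adj u v" "adj v u" "u \<in> V"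
    using n u adj_commute by auto
  have "oth u v \<in> N u" using n by blast
  then show "adj u (oth u v)" using in_N by blast
  then show "oth u v \<in> V - D2" using n D2_indep u by blast
qed

lemma weak_symm: "v \<in> V - D2 \<Longrightarrow> u \<in> weak v \<Longrightarrow> u \<in> weak (oth u v)"
  using weak_oth[of v u] adj_commute in_N unfolding weak_def by blast

text \<open>Since \<open>D2\<close> is independent, the vertices of U can be coloured independently
  of each other. If no extension exists, one of them fails alone, and \<open>common_color\<close>
  leaves a single reason for that.\<close>

lemma D2_clash:
  assumes "U \<subseteq> D2" "good adj sg g (V - U)"
  obtains u a b where "u \<in> U" "N u = {a, b}" "a \<noteq> b"
    "(g a - g b) mod 6 = (if sg u a = sg u b then 3 else 0)"
proof (rule ccontr)
  note witness = that
  assume no: "\<not> thesis"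
  have "\<exists>c. \<forall>a\<in>N u. far (g a - c) = sg a u" if u: "u \<in> U" for u
  proof -
    obtain a b where ab: "N u = {a, b}" "a \<noteq> b" 
      using u assms(1) unfolding D2_def by (auto simp: card_2_iff)
    then have "(g a - g b) mod 6 \<noteq> (if sg u a = sg u b then 3 else 0)" using no witness u by blast
    then obtain c where "far (g a - c) = sg u a" "far (g b - c) = sg u b"
      using common_color by blast
    then show ?thesis using ab sg_commute by auto
  qed
  then obtain cu where cu: "\<And>u a. u \<in> U \<Longrightarrow> a \<in> N u \<Longrightarrow> far (g a - cu u) = sg a u" by metis
  define F where "F v = (if v \<in> U then cu v else g v)" for v
  have "far (F a - F b) = sg a b" if ab: "a \<in> V" "b \<in> V" "adj a b" for a b
  proof -
    consider "a \<in> U" "b \<in> U" | "a \<in> U" "b \<notin> U" | "a \<notin> U" "b \<in> U" | "a \<notin> U" "b \<notin> U" by blast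
    then show ?thesis
    proof cases
      case 1 then show ?thesis using D2_indep assms(1) ab by blast
    next
      case 2 
      then have "far (g b - cu a) = sg b a" using cu ab in_N by blast
      then show ?thesis using 2 far_minus_commute sg_commute unfolding F_def by metis
    next
      case 3 then show ?thesis using cu[of b a] ab adj_commute in_N unfolding F_def by simp
    next
      case 4 then show ?thesis using assms(2) ab unfolding good_def F_def by simp
    qed
  qed
  then show False using not_good_V unfolding good_def by blast
qed

text \<open>The weak neighbours of C are erased and coloured last, so each of them bars one residue
  instead of three. By \<open>one\<close> the far end of such a neighbour keeps its colour under
  \<open>f\<close>, which makes \<open>forb f\<close> the right value after the recolouring.\<close>

lemma recolor:
  assumes C: "C \<subseteq> V - D2" and one: "\<And>z u. z \<in> C \<Longrightarrow> u \<in> weak z \<Longrightarrow> oth u z \<notin> C"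
    and f: "good adj sg f (V - (C \<union> \<Union>(weak ` C)))"
    and core: "\<And>y z. y \<in> C \<Longrightarrow> z \<in> C \<Longrightarrow> adj y z \<Longrightarrow> far (c y - c z) = sg y z"
    and ext: "\<And>z a. z \<in> C \<Longrightarrow> a \<in> strong z - C \<Longrightarrow> far (f a - c z) = sg a z"
    and wk: "\<And>z u. z \<in> C \<Longrightarrow> u \<in> weak z \<Longrightarrow> c z mod 6 \<noteq> forb f z u mod 6"
  shows False
proof -
  define U where "U = \<Union>(weak ` C)"
  define g where "g v = (if v \<in> C then c v else f v)" for v
  have U: "U \<subseteq> D2" unfolding U_def weak_def by blast
  have "good adj sg g (V - U)"
    unfolding good_def
  proof (intro ballI impI)
    fix a b assume ab: "a \<in> V - U" "b \<in> V - U" "adj a b"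
    have str: "x \<in> strong z" if "z \<in> C" "x \<in> V - U" "adj z x" for x z
      using that in_N unfolding strong_def U_def weak_def by blast
    consider "a \<in> C" "b \<in> C" | "a \<in> C" "b \<notin> C" | "a \<notin> C" "b \<in> C" | "a \<notin> C" "b \<notin> C" by blast
    then show "far (g a - g b) = sg a b"
    proof cases
      case 1 then show ?thesis using core ab unfolding g_def by simp
    next
      case 2
      then have "far (f b - c a) = sg b a" using ext[of a b] str[of a b] ab by blast
      then show ?thesis using 2 far_minus_commute sg_commute unfolding g_def by metis
    next
      case 3
      then show ?thesis using ext[of b a] str[of b a] ab adj_commute unfolding g_def by simp
    next
      case 4 then show ?thesis using f ab unfolding good_def g_def U_def by simp
    qed
  qed
  from D2_clash[OF U this] obtain u a b where u: "u \<in> U" "N u = {a, b}" "a \<noteq> b"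
    and cl: "(g a - g b) mod 6 = (if sg u a = sg u b then 3 else 0)" by metis
  obtain z where z: "z \<in> C" "u \<in> weak z" using u unfolding U_def by blast
  have zV: "z \<in> V - D2" using z C by blast
  note n = weak_oth[OF zV z(2)]
  define w where "w = oth u z"
  \<comment> \<open>The clash does not depend on the order of the two neighbours, as 0 and 3 are
    their own negatives modulo 6.\<close>
  have "(g z - g w) mod 6 = (if sg u z = sg u w then 3 else 0)"
  proof (cases "a = z")
    case True
    then have "b = w" using n u unfolding w_def by (auto simp: doubleton_eq_iff)
    then show ?thesis using True cl by simp
  next
    case False
    then have "b = z" "a = w" using n u unfolding w_def by (auto simp: doubleton_eq_iff)
    then have "(g w - g z) mod 6 = (if sg u z = sg u w then 3 else 0)" using cl by auto
    then show ?thesis using zmod_zminus1_eq_if[of "g w - g z" 6] by (auto split: if_splits)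
  qed
  moreover have "g z = c z" "g w = f w" using z one unfolding g_def w_def by auto
  ultimately have "(c z - f w) mod 6 = (if sg u z = sg u w then 3 else 0) mod 6" by auto
  then have "(c z - f w + f w) mod 6 = ((if sg u z = sg u w then 3 else 0) + f w) mod 6"
    by (rule mod_add_cong) simp
  then have "c z mod 6 = forb f z u mod 6"
    unfolding forb_def center_def w_def[symmetric] by (simp add: algebra_simps)
  then show False using wk z by blast
qed

lemma recolor_star:
  assumes v: "v \<in> V - D2" and f: "good adj sg f (V - insert v (weak v))"
    and ext: "\<And>a. a \<in> strong v \<Longrightarrow> far (f a - c) = sg a v"
    and wk: "\<And>u. u \<in> weak v \<Longrightarrow> c mod 6 \<noteq> forb f v u mod 6"
  shows False
proof (rule recolor[of "{v}" f "\<lambda>_. c"])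
  show "good adj sg f (V - ({v} \<union> \<Union>(weak ` {v})))" using f by simp
qed (use v ext wk weak_oth[OF v] in auto)

text \<open>Without strong neighbours all six residues are open, and each weak neighbour closes at
  most one.\<close>

lemma weak_ge_6:
  assumes v: "v \<in> V - D2" "strong v = {}"
  shows "card (weak v) \<ge> 6"
proof (rule ccontr)
  assume "\<not> ?thesis"
  moreover obtain f where f: "good adj sg f (V - insert v (weak v))"
    using colorable_proper[of "V - insert v (weak v)"] v by blast
  ultimately have "card (forb f v ` weak v) < card {0..<6::int}"
    using card_image_le[of "weak v" "forb f v"] by simp
  moreover have "inj_on (\<lambda>x. x mod 6) {0..<6::int}" by (auto simp: inj_on_def)
  ultimately obtain c where "\<And>x. x \<in> forb f v ` weak v \<Longrightarrow> c mod 6 \<noteq> x mod 6"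
    using avoid_residues[of "{0..<6::int}" "forb f v ` weak v"] by (metis finite_atLeastLessThan_int finite_imageI fin_weak)
  then show False using recolor_star[OF v(1) f, of c] v(2) by blast
qed

text \<open>The strong neighbour leaves three consecutive residues. A forbidden residue outside this
  interval is harmless, hence the alternative with \<open>far\<close>; fewer than three others
  cannot fill the interval.\<close>

lemma recolor_single:
  assumes v: "v \<in> V - D2" "strong v = {x}" and f: "good adj sg f (V - insert v (weak v))"
    and F: "finite F" "card F < 3"
      "\<And>u. u \<in> weak v \<Longrightarrow> far (forb f v u - center (f x) (sg x v)) \<or> forb f v u \<in> F"
  shows False
proof -
  define \<alpha> where "\<alpha> = center (f x) (sg x v)"
  obtain c where c: "c \<in> {\<alpha> - 1, \<alpha>, \<alpha> + 1}" "\<And>x. x \<in> F \<Longrightarrow> c mod 6 \<noteq> x mod 6"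
    using avoid_residues[of "{\<alpha> - 1, \<alpha>, \<alpha> + 1}" F] near_interval[of \<alpha>] F(1,2) by auto
  have nc: "\<not> far (c - \<alpha>)" using near_interval(3)[OF c(1)] .
  show False
  proof (rule recolor_star[OF v(1) f, of c])
    show "far (f a - c) = sg a v" if "a \<in> strong v" for a
      using that v(2) nc far_eq_iff unfolding \<alpha>_def by simp
    show "c mod 6 \<noteq> forb f v u mod 6" if "u \<in> weak v" for u
      using F(3)[OF that] c(2) nc far_cong[of "c - \<alpha>" "forb f v u - \<alpha>"] mod_diff_cong[of c 6 "forb f v u" \<alpha> \<alpha>]
      unfolding \<alpha>_def by blast
  qed
qed

lemma weak_ge_3:
  assumes v: "v \<in> V - D2" "strong v = {x}"
  shows "card (weak v) \<ge> 3"
proof (rule ccontr)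
  assume a: "\<not> ?thesis"
  obtain f where f: "good adj sg f (V - insert v (weak v))"
    using colorable_proper[of "V - insert v (weak v)"] v by blast
  show False
    using recolor_single[OF v f, of "forb f v ` weak v"] a card_image_le[of "weak v" "forb f v"] by simp
qed

text \<open>The only two kinds of vertices with positive excess.\<close>

definition "badB v \<longleftrightarrow> v \<in> V - D2 \<and> card (strong v) = 1 \<and> card (weak v) = 3"

definition "badA v \<longleftrightarrow> v \<in> V - D2 \<and> card (strong v) = 2 \<and> card (weak v) = 1"

text \<open>Weak neighbours with a common far end forbid equal or antipodal residues. Equal ones
  count once; of two antipodal ones, one lies outside the interval left by \<open>x\<close>. So at
  most two obstacles face three residues.\<close>

lemma badB_oth_inj:
  assumes B: "badB v"
  shows "inj_on (\<lambda>u. oth u v) (weak v)"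
proof (rule inj_onI, rule ccontr)
  fix u u' assume u: "u \<in> weak v" "u' \<in> weak v" "oth u v = oth u' v" "u \<noteq> u'"
  obtain x where x: "strong v = {x}" using B unfolding badB_def by (auto simp: card_1_singleton_iff)
  have v: "v \<in> V - D2" using B unfolding badB_def by blast
  obtain f where f: "good adj sg f (V - insert v (weak v))"
    using colorable_proper[of "V - insert v (weak v)"] v by blast
  define \<alpha> where "\<alpha> = center (f x) (sg x v)"
  define w where "w = oth u v"
  have fu: "forb f v u = center (f w) (sg u v = sg u w)" "forb f v u' = center (f w) (sg u' v = sg u' w)"
    using u unfolding forb_def w_def by simp_all
  have "\<exists>y\<in>{u, u'}. far (forb f v y - \<alpha>) \<or> forb f v u = forb f v u'"
  proof (cases "(sg u v = sg u w) = (sg u' v = sg u' w)")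
    case True
    then have "forb f v u = forb f v u'" using fu by simp
    then show ?thesis by blast
  next
    case False
    then show ?thesis using fu far_add_3[of "f w - \<alpha>"] unfolding center_def
      by (auto simp: algebra_simps)
  qed
  then obtain y where y: "y \<in> {u, u'}" "far (forb f v y - \<alpha>) \<or> forb f v u = forb f v u'" by blast
  have yw: "y \<in> weak v" using y u by blast
  have "card (weak v - {y}) = 2" using B yw unfolding badB_def by simp
  then have cf: "card (forb f v ` (weak v - {y})) < 3"
    using card_image_le[of "weak v - {y}" "forb f v"] by simp
  show False
  proof (rule recolor_single[OF v x f _ cf])
    fix z assume "z \<in> weak v"
    then show "far (forb f v z - center (f x) (sg x v)) \<or> forb f v z \<in> forb f v ` (weak v - {y})"
    proof (cases "z = y")
      case False
      then show ?thesis using \<open>z \<in> weak v\<close> by blast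
    next
      case True
      obtain y' where "y' \<in> weak v - {y}" "forb f v u = forb f v u' \<Longrightarrow> forb f v y = forb f v y'"
        using y(1) u by auto
      then show ?thesis using y(2) True unfolding \<alpha>_def by blast
    qed
  qed simp
qed

text \<open>Otherwise an edge between \<open>x\<close> and the far end can be imposed, with the sign
  that moves the residue forbidden by \<open>u\<close> out of the interval left by \<open>x\<close>.
  The vertices \<open>v\<close> and \<open>u\<close> are the two missing ones that
  \<open>add_edge\<close> asks for.\<close>

lemma badB_oth:
  assumes B: "badB v" and x: "strong v = {x}" and u: "u \<in> weak v"
  shows "oth u v = x \<or> adj x (oth u v)"
proof (rule ccontr)
  assume na: "\<not> ?thesis"
  have v: "v \<in> V - D2" using B unfolding badB_def by blast
  define w where "w = oth u v"
  note n = weak_oth[OF v u]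
  have xs: "x \<in> V - D2" "x \<noteq> v" using x strongD[of x v] by auto
  have wd: "weak v \<subseteq> D2" unfolding weak_def by blast
  have "x \<noteq> w" using na unfolding w_def by blast
  obtain f where f: "good adj sg f (V - insert v (weak v))"
    and fw: "far (f w - f x) = ((sg u v = sg u w) = sg x v)"
  proof (rule add_edge[of "V - insert v (weak v)" v u w x "(sg u v = sg u w) = sg x v"])
    show "w \<in> V - insert v (weak v)" using n wd unfolding w_def by blast
    show "x \<in> V - insert v (weak v)" using xs wd by blast
  qed (use n u v na \<open>x \<noteq> w\<close> adj_commute w_def in auto)
  have "far (forb f v u - center (f x) (sg x v))"
    using fw unfolding forb_def w_def[symmetric] far_center_diff by blast
  moreover have "card (weak v - {u}) = 2" using B u unfolding badB_def by simp
  then have "card (forb f v ` (weak v - {u})) < 3"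
    using card_image_le[of "weak v - {u}" "forb f v"] by simp
  ultimately show False
    using recolor_single[OF v x f, of "forb f v ` (weak v - {u})"] by (metis DiffI fin_weak finite_Diff finite_imageI imageI singletonD)
qed

text \<open>The second conclusion makes the triangle positive. If either fails, an edge between
  \<open>x\<close> and \<open>y\<close> can be imposed that brings the two centres within distance
  1. Then \<open>v\<close> has at least two common colours, and its one weak neighbour bars only
  one.\<close>

lemma badA_triangle:
  assumes A: "badA v" and xy: "strong v = {x, y}" "x \<noteq> y"
  shows "adj x y" "sg x y = (sg x v = sg y v)"
proof -
  have v: "v \<in> V - D2" using A unfolding badA_def by blast
  have "adj x y \<and> sg x y = (sg x v = sg y v)"
  proof (rule ccontr)
    assume na: "\<not> ?thesis"
    obtain u where u: "weak v = {u}" using A unfolding badA_def by (auto simp: card_1_singleton_iff)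
    note n = weak_oth[OF v, of u]
    have xs: "x \<in> V - D2" "x \<noteq> v" "y \<in> V - D2" "y \<noteq> v"
      using xy strongD[of x v] strongD[of y v] by auto
    obtain f where f: "good adj sg f (V - insert v (weak v))"
      and fxy: "far (f x - f y) = (sg x v \<noteq> sg y v)"
    proof (rule add_edge[of "V - insert v (weak v)" v u x y "sg x v \<noteq> sg y v"])
    qed (use n u v na xs xy in auto)
    define \<alpha> \<beta> where "\<alpha> = center (f x) (sg x v)" and "\<beta> = center (f y) (sg y v)"
    have nab: "\<not> far (\<alpha> - \<beta>)" using fxy unfolding \<alpha>_def \<beta>_def far_center_diff by blast
    \<comment> \<open>If the centres differ, both are common colours; if they coincide,
      \<open>\<alpha>\<close> and \<open>\<alpha> + 1\<close> are.\<close>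
    obtain c where c: "\<not> far (c - \<alpha>)" "\<not> far (c - \<beta>)" "c mod 6 \<noteq> forb f v u mod 6"
    proof (cases "\<alpha> mod 6 = \<beta> mod 6")
      case True
      have "\<not> far (\<alpha> + 1 - \<alpha>)" "\<not> far (\<alpha> + 1 - \<beta>)"
        using far_cong[of "\<alpha> + 1 - \<beta>" "\<alpha> + 1 - \<alpha>"] mod_diff_cong[of "\<alpha> + 1" 6 "\<alpha> + 1" \<beta> \<alpha>] True
        by (simp_all add: far_def)
      moreover have "(\<alpha> + 1) mod 6 \<noteq> \<alpha> mod 6" by (simp add: mod_eq_dvd_iff)
      ultimately show thesis using that[of \<alpha>] that[of "\<alpha> + 1"] nab by (metis diff_self far_0)
    next
      case False
      then show thesis using that[of \<alpha>] that[of \<beta>] nab far_minus_commute by (metis diff_self far_0)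
    qed
    show False
      by (rule recolor_star[OF v f, of c]) (use c xy u far_eq_iff \<alpha>_def \<beta>_def in auto)
  qed
  then show "adj x y" "sg x y = (sg x v = sg y v)" by auto
qed

section \<open>Vertices with a single strong neighbour\<close>

definition "Bs = {v. badB v}"

lemma Bs_sub: "Bs \<subseteq> V - D2"
  unfolding Bs_def badB_def by blast

lemma fin_Bs [simp]: "finite Bs"
  using Bs_sub fin finite_subset by blast

lemma pot_ge_2:
  assumes "S \<subseteq> V" "card S \<ge> 4"
  shows "pot adj S \<ge> 2"
proof (cases "S = V")
  case False
  then show ?thesis using pot_ge_3[of S] assms by (simp add: psubset_eq)
qed (use big in simp)

lemma deg_ge_3:
  assumes "v \<in> V - D2"
  shows "card (strong v) + card (weak v) \<ge> 3"
  using deg_ge_2[of v] assms card_N[of v] unfolding D2_def by force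

definition ends_of :: "'v \<Rightarrow> 'v set" where
  "ends_of v = (\<lambda>u. oth u v) ` weak v"

lemma card_ends_of: "badB v \<Longrightarrow> card (ends_of v) = 3"
  unfolding ends_of_def using badB_oth_inj card_image unfolding badB_def by fastforce

lemma badB_strong:
  assumes "badB v" "v \<in> strong x" 
  shows "x \<in> V - D2 \<Longrightarrow> strong v = {x}"
proof -
  assume "x \<in> V - D2"
  then have "x \<in> strong v" using strongD[OF assms(2)] in_N unfolding strong_def by blast
  then show "strong v = {x}" using assms(1) unfolding badB_def by (auto simp: card_1_singleton_iff)
qed

lemma ends_of_sub:
  assumes x: "x \<in> V - D2" and v: "v \<in> strong x" "badB v"
  shows "ends_of v \<subseteq> insert x (strong x - {v})"
proof
  fix w assume "w \<in> ends_of v"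
  then obtain u where u: "u \<in> weak v" "w = oth u v" unfolding ends_of_def by blast
  have "v \<in> V - D2" using v(2) unfolding badB_def by blast
  from weak_oth(2,3)[OF this u(1)] have "w \<noteq> v" "w \<in> V - D2" using u(2) by auto
  moreover have "w = x \<or> adj x w"
    using badB_oth[OF v(2) badB_strong[OF v(2,1) x] u(1)] u(2) by simp
  ultimately show "w \<in> insert x (strong x - {v})"
    unfolding strong_def nb_def by simp
qed

text \<open>A vertex of \<open>B1 x\<close> shares a weak neighbour with \<open>x\<close>, which
  offsets it in the excess of \<open>x\<close>. A vertex of \<open>B2 x\<close> has its three far
  ends among the other strong neighbours of \<open>x\<close>, which limits the number of such
  vertices.\<close>

definition "B1 x = {v \<in> strong x. badB v \<and> x \<in> ends_of v}"

definition "B2 x = {v \<in> strong x. badB v \<and> x \<notin> ends_of v}"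

lemma nb_Bs:
  assumes "x \<in> V - D2"
  shows "nb adj Bs x = B1 x \<union> B2 x"
  using Bs_sub unfolding nb_def B1_def B2_def Bs_def strong_def by auto

lemma card_B1:
  assumes "x \<in> V - D2"
  shows "card (B1 x) \<le> card (weak x)"
proof -
  have "B1 x \<subseteq> (\<lambda>u. oth u x) ` weak x"
  proof
    fix v assume "v \<in> B1 x"
    then have v: "v \<in> strong x" "badB v" "x \<in> ends_of v" unfolding B1_def by auto
    then obtain u where u: "u \<in> weak v" "x = oth u v" unfolding ends_of_def by blast
    have vV: "v \<in> V - D2" using v(2) unfolding badB_def by blast
    have ux: "u \<in> weak x" using weak_symm[OF vV u(1)] u(2) by simp
    have "v = oth u x"
      using weak_oth[OF vV u(1)] weak_oth[OF assms ux] u(2) by (auto simp: doubleton_eq_iff)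
    then show "v \<in> (\<lambda>u. oth u x) ` weak x" using ux by blast
  qed
  then show ?thesis by (rule surj_card_le[OF fin_weak])
qed

lemma B2_ends:
  assumes "x \<in> V - D2" "v \<in> B2 x"
  shows "ends_of v \<subseteq> strong x - {v}" "card (strong x) \<ge> 4"
proof -
  have v: "v \<in> strong x" "badB v" "x \<notin> ends_of v" using assms unfolding B2_def by auto
  show s: "ends_of v \<subseteq> strong x - {v}" using ends_of_sub[OF assms(1) v(1,2)] v(3) by blast
  have "card (ends_of v) \<le> card (strong x - {v})" using card_mono[OF _ s] by simp
  then show "card (strong x) \<ge> 4" using card_ends_of[OF v(2)] v(1) by simp
qed

lemma card_strong_B1:
  assumes "x \<in> V - D2" "v \<in> B1 x"
  shows "card (strong x) \<ge> 3"
proof -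
  have v: "v \<in> strong x" "badB v" using assms unfolding B1_def by auto
  have "ends_of v - {x} \<subseteq> strong x - {v}" using ends_of_sub[OF assms(1) v] by blast
  then have "card (ends_of v - {x}) \<le> card (strong x - {v})" by (intro card_mono) auto
  moreover have "card (ends_of v - {x}) \<ge> 2"
    using card_ends_of[OF v(2)] diff_card_le_card_Diff[of "{x}" "ends_of v"] by simp
  ultimately show ?thesis using v(1) by simp
qed

text \<open>The potential of \<open>x\<close>, its strong neighbours and the vertices of \<open>inner x\<close> bounds the number of
  the latter, hence the number of bad neighbours of \<open>x\<close>.\<close>

definition "inner x = {u \<in> D2. N u \<subseteq> strong x}"

lemma fin_inner [simp]: "finite (inner x)"
  unfolding inner_def by simp

lemma B2_weak_inner:
  assumes "x \<in> V - D2" "v \<in> B2 x"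
  shows "weak v \<subseteq> inner x"
proof
  fix u assume u: "u \<in> weak v"
  have v: "v \<in> V - D2" "v \<in> strong x" using assms unfolding B2_def badB_def by auto
  have "oth u v \<in> strong x" using B2_ends[OF assms] u unfolding ends_of_def by blast
  then show "u \<in> inner x" using weak_oth[OF v(1) u] v unfolding inner_def by simp
qed

lemma links_inner: "links adj (inner x) (strong x) = 2 * card (inner x)"
proof -
  have "card (nb adj (strong x) u) = 2" if "u \<in> inner x" for u
  proof -
    have "nb adj (strong x) u = N u"
      using that in_N unfolding inner_def nb_def strong_def by blast
    then show ?thesis using that unfolding inner_def D2_def by simp
  qed
  then show ?thesis unfolding links_def by simp
qed

text \<open>With s strong neighbours, these and \<open>x\<close> together have potential at most s +
  3. Each inner vertex contributes at most 3 - 4 = -1, as both its edges end in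
  \<open>strong x\<close>, and the total is at least 2.\<close>

lemma card_inner:
  assumes x: "x \<in> V - D2" and s: "card (strong x) \<ge> 3"
  shows "card (inner x) \<le> card (strong x) + 1"
proof -
  define M where "M = strong x"
  have M: "finite M" "x \<notin> M" "M \<inter> D2 = {}" "M \<subseteq> V"
    using strongD unfolding M_def by (simp, blast+)
  have I: "inner x \<subseteq> D2" unfolding inner_def by blast
  have "nb adj M x = M" using strongD unfolding nb_def M_def by blast
  then have "pot adj (insert x M) \<le> 3 + int (card M)"
    using pot_insert[OF M(1,2) ss] unfolding pot_def[of adj M] by simp
  moreover have "pot adj (inner x) \<le> 3 * int (card (inner x))" unfolding pot_def by simp
  moreover have "links adj (inner x) (insert x M) \<ge> 2 * card (inner x)"
  proof -
    have "links adj (inner x) M \<le> links adj (inner x) (insert x M)"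
      unfolding links_def nb_def using M(1) by (intro sum_mono card_mono) auto
    then show ?thesis using links_inner unfolding M_def by simp
  qed
  moreover have "pot adj (inner x \<union> insert x M)
      = pot adj (inner x) + pot adj (insert x M) - 2 * int (links adj (inner x) (insert x M))"
    using M I x adj_commute by (intro pot_Un) auto
  moreover have "pot adj (inner x \<union> insert x M) \<ge> 2"
  proof (rule pot_ge_2)
    show "inner x \<union> insert x M \<subseteq> V" using M I x D2_sub by blast
    have "card (insert x M) \<le> card (inner x \<union> insert x M)"
      using M by (intro card_mono) auto
    then show "4 \<le> card (inner x \<union> insert x M)" using s M by (simp add: M_def)
  qed
  ultimately show ?thesis unfolding M_def by linarith
qed

text \<open>A vertex of \<open>B2 x\<close> is joined through weak neighbours to all three other
  strong neighbours. Three such vertices meet all six pairs, which would give six inner vertices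
  where at most five are possible.\<close>

lemma card_B2_4:
  assumes x: "x \<in> V - D2" and s: "card (strong x) = 4"
  shows "card (B2 x) \<le> 2"
proof (rule ccontr)
  assume a: "\<not> ?thesis"
  have sub: "B2 x \<subseteq> strong x" unfolding B2_def by blast
  have "{K. K \<subseteq> strong x \<and> card K = 2} \<subseteq> N ` inner x"
  proof
    fix K assume "K \<in> {K. K \<subseteq> strong x \<and> card K = 2}"
    then have K: "K \<subseteq> strong x" "card K = 2" by auto
    have "K \<inter> B2 x \<noteq> {}"
    proof
      assume e: "K \<inter> B2 x = {}"
      then have "card (K \<union> B2 x) = card K + card (B2 x)"
        using K sub by (intro card_Un_disjoint) (auto intro: finite_subset[OF _ fin_strong])
      moreover have "card (K \<union> B2 x) \<le> card (strong x)" using K sub by (intro card_mono) auto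
      ultimately show False using a K s by simp
    qed
    then obtain v where v: "v \<in> K" "v \<in> B2 x" by blast
    then obtain z where z: "K = {v, z}" "z \<noteq> v" using K(2) by (auto simp: card_2_iff)
    have "badB v" using v unfolding B2_def by blast
    then have "ends_of v = strong x - {v}"
      using B2_ends(1)[OF x v(2)] card_ends_of s v sub by (intro card_subset_eq) auto
    then have "z \<in> ends_of v" using K z by blast
    then obtain u where u: "u \<in> weak v" "z = oth u v" unfolding ends_of_def by blast
    have "v \<in> V - D2" using \<open>badB v\<close> unfolding badB_def by blast
    then have "N u = K" using weak_oth[of v u] u z by simp
    then show "K \<in> N ` inner x" using B2_weak_inner[OF x v(2)] u by blast
  qed
  then have "card {K. K \<subseteq> strong x \<and> card K = 2} \<le> card (inner x)"
    by (rule surj_card_le[OF fin_inner])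
  moreover have "card {K. K \<subseteq> strong x \<and> card K = 2} = 6"
    using n_subsets[OF fin_strong[of x], of 2] s by (simp add: numeral_eq_Suc)
  ultimately show False using card_inner[OF x] s by simp
qed

text \<open>Five such vertices would send 15 edges to inner vertices, but at most six inner vertices
  with two edges each receive only 12.\<close>

lemma card_B2_5:
  assumes x: "x \<in> V - D2" and s: "card (strong x) = 5"
  shows "card (B2 x) \<le> 4"
proof (rule ccontr)
  assume a: "\<not> ?thesis"
  have sub: "B2 x \<subseteq> strong x" unfolding B2_def by blast
  then have all: "B2 x = strong x" using a s card_mono[OF fin_strong sub] by (intro card_subset_eq) auto
  have "3 \<le> card (nb adj (inner x) v)" if v: "v \<in> strong x" for v
  proof -
    have "weak v \<subseteq> nb adj (inner x) v"
      using B2_weak_inner[OF x] v all in_N unfolding nb_def weak_def by blast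
    then have "card (weak v) \<le> card (nb adj (inner x) v)"
      by (intro card_mono) (auto simp: nb_def)
    moreover have "card (weak v) = 3" using v all unfolding B2_def badB_def by blast
    ultimately show ?thesis by simp
  qed
  then have "links adj (strong x) (inner x) \<ge> 15"
    unfolding links_def using sum_bounded_below[of "strong x" 3 "\<lambda>v. card (nb adj (inner x) v)"] s
    by simp
  moreover have "links adj (strong x) (inner x) = links adj (inner x) (strong x)"
    using adj_commute by (intro links_commute) auto
  ultimately show False using links_inner[of x] card_inner[OF x] s by simp
qed

text \<open>Weak neighbours offset \<open>B1 x\<close>, so for s strong neighbours it is enough that
  \<open>B2 x\<close> has at most 2s - 6 elements. This is trivial for s at least 6,
  \<open>B2 x\<close> is empty for s = 3, and s = 4, 5 are the two preceding counts.\<close>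

lemma excess_Bs:
  assumes x: "x \<in> V - D2" and ne: "nb adj Bs x \<noteq> {}"
  shows "excess x + int (card (nb adj Bs x)) \<le> 0" "card (strong x) \<ge> 3"
proof -
  have c: "card (nb adj Bs x) \<le> card (B1 x) + card (B2 x)"
    unfolding nb_Bs[OF x] by (rule card_Un_le)
  show s3: "card (strong x) \<ge> 3"
    using ne nb_Bs[OF x] card_strong_B1[OF x] B2_ends(2)[OF x] by fastforce
  have "int (card (B2 x)) \<le> 2 * int (card (strong x)) - 6"
  proof (cases "B2 x = {}")
    case False
    then have "card (strong x) \<ge> 4" using B2_ends(2)[OF x] by blast
    then consider "card (strong x) = 4" | "card (strong x) = 5" | "card (strong x) \<ge> 6" by linarith
    then show ?thesis
    proof cases
      case 3
      have "card (B2 x) \<le> card (strong x)" by (intro card_mono) (auto simp: B2_def)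
      then show ?thesis using 3 by linarith
    qed (use card_B2_4[OF x] card_B2_5[OF x] in auto)
  qed (use s3 in simp)
  then show "excess x + int (card (nb adj Bs x)) \<le> 0"
    using c card_B1[OF x] unfolding excess_def by linarith
qed

section \<open>Total charge and the bound at a single vertex\<close>

lemma sum_excess: "(\<Sum>x\<in>V - D2. excess x) = 2 * pot adj V"
proof -
  define W where "W = V - D2"
  have W: "finite W" "W \<inter> D2 = {}" "V = W \<union> D2" using fin D2_sub unfolding W_def by auto
  have st: "nb adj W v = strong v" for v unfolding W_def strong_def nb_def by auto
  have wk: "nb adj D2 v = weak v" for v using D2_sub unfolding weak_def nb_def by auto
  have "nb adj W u = N u" if "u \<in> D2" for u
    using that D2_indep unfolding W_def nb_def by blast
  then have "links adj D2 W = 2 * card D2"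
    unfolding links_def by (simp add: D2_def)
  moreover have "links adj W D2 = links adj D2 W"
    using W adj_commute by (intro links_commute) auto
  moreover have "links adj D2 D2 = 0" using D2_indep unfolding links_def nb_def by simp
  moreover have "links adj (W \<union> D2) (W \<union> D2)
      = links adj W W + links adj D2 W + (links adj W D2 + links adj D2 D2)"
    using W(1,2) by (simp add: links_Un_left links_Un_right)
  then have "links adj V V = links adj W W + links adj D2 W + (links adj W D2 + links adj D2 D2)"
    unfolding W(3)[symmetric] .
  moreover have "card (W \<union> D2) = card W + card D2" using W(1,2) by (intro card_Un_disjoint) auto
  then have "card V = card W + card D2" unfolding W(3)[symmetric] .
  moreover have "(\<Sum>x\<in>W. excess x)
      = 6 * int (card W) - 2 * int (links adj W W) - int (links adj W D2)"
    unfolding excess_def links_def st wk by (simp add: sum_subtractf sum_distrib_left)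
  ultimately show ?thesis unfolding W_def[symmetric] pot_def by simp
qed

lemma sum_Bs: "(\<Sum>x\<in>V - D2. card (nb adj Bs x)) = card Bs"
proof -
  have "nb adj (V - D2) v = strong v" for v unfolding strong_def nb_def by auto
  then have "links adj Bs (V - D2) = card Bs"
    unfolding links_def by (simp add: Bs_def badB_def)
  moreover have "links adj (V - D2) Bs = links adj Bs (V - D2)"
    using fin adj_commute by (intro links_commute) auto
  ultimately show ?thesis unfolding links_def by simp
qed

lemma excess_le:
  assumes v: "v \<in> V - D2" "\<not> badA v"
  shows "excess v \<le> (if badB v then 1 else 0)"
proof -
  consider "card (strong v) = 0" | "card (strong v) = 1" | "card (strong v) = 2" | "card (strong v) \<ge> 3"
    by linarith
  then show ?thesis
  proof cases
    case 1
    then show ?thesis using weak_ge_6[OF v(1)] unfolding excess_def by simp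
  next
    case 2
    then obtain x where "strong v = {x}" by (auto simp: card_1_singleton_iff)
    then have "card (weak v) \<ge> 3" using weak_ge_3[OF v(1)] by blast
    then show ?thesis using 2 v unfolding excess_def badB_def by auto
  next
    case 3
    then have "card (weak v) \<ge> 2" using deg_ge_3[OF v(1)] v unfolding badA_def by auto
    then show ?thesis using 3 unfolding excess_def by simp
  next
    case 4
    then show ?thesis unfolding excess_def by simp
  qed
qed

end

section \<open>Triangles containing a vertex of type A\<close>

text \<open>All colourings of an all-positive triangle. Every requirement to avoid one residue at one vertex
  excludes two of the twelve, so five such requirements can always be met.\<close>

definition triples :: "(int \<times> int \<times> int) set" where
  "triples = {(0, 2, 4), (0, 4, 2), (2, 0, 4), (2, 4, 0), (4, 0, 2), (4, 2, 0),
              (1, 3, 5), (1, 5, 3), (3, 1, 5), (3, 5, 1), (5, 1, 3), (5, 3, 1)}"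

lemma triples_props:
  assumes "(i, j, l) \<in> triples"
  shows "far (i - j)" "far (i - l)" "far (j - l)"
    "i \<in> {0, 1, 2, 3, 4, 5}" "j \<in> {0, 1, 2, 3, 4, 5}" "l \<in> {0, 1, 2, 3, 4, 5}"
    "i mod 6 = i" "j mod 6 = j" "l mod 6 = l"
  using assms unfolding triples_def by (auto simp: far_def)

lemma finite_triples [simp]: "finite triples" and card_triples: "card triples = 12"
  unfolding triples_def by simp_all

lemma residue_card:
  fixes r :: int
  assumes "g \<in> {fst, fst \<circ> snd, snd \<circ> snd}"
  shows "card {t \<in> triples. g t = r mod 6} \<le> 2"
proof -
  have "\<forall>r\<in>{0, 1, 2, 3, 4, 5 :: int}. card {t \<in> triples. fst t = r} \<le> 2"
    "\<forall>r\<in>{0, 1, 2, 3, 4, 5 :: int}. card {t \<in> triples. fst (snd t) = r} \<le> 2"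
    "\<forall>r\<in>{0, 1, 2, 3, 4, 5 :: int}. card {t \<in> triples. snd (snd t) = r} \<le> 2"
    unfolding triples_def by code_simp+
  from this[THEN bspec, OF mod_6_cases[of r]] show ?thesis
    using assms by auto
qed

lemma triple_avoiding:
  assumes F: "finite F1" "finite F2" "finite F3" "card F1 + card F2 + card F3 \<le> 5"
  obtains i j l where "(i, j, l) \<in> triples"
    "\<forall>r\<in>F1. i \<noteq> r mod 6" "\<forall>r\<in>F2. j \<noteq> r mod 6" "\<forall>r\<in>F3. l \<noteq> r mod 6"
proof -
  define B where "B g F = (\<Union>r\<in>F. {t \<in> triples. g t = r mod 6})"
    for g :: "int \<times> int \<times> int \<Rightarrow> int" and F :: "int set"
  have B: "card (B g F) \<le> 2 * card F" if "g \<in> {fst, fst \<circ> snd, snd \<circ> snd}" "finite F" for g F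
  proof -
    have "card (B g F) \<le> (\<Sum>r\<in>F. card {t \<in> triples. g t = r mod 6})"
      unfolding B_def by (rule card_UN_le[OF that(2)])
    also have "\<dots> \<le> card F * 2"
      using sum_bounded_above[of F "\<lambda>r. card {t \<in> triples. g t = r mod 6}" 2]
        residue_card[OF that(1)] by simp
    finally show ?thesis by simp
  qed
  define all where "all = B fst F1 \<union> B (fst \<circ> snd) F2 \<union> B (snd \<circ> snd) F3"
  have "card all \<le> card (B fst F1) + card (B (fst \<circ> snd) F2) + card (B (snd \<circ> snd) F3)"
    unfolding all_def by (meson card_Un_le add_le_mono1 le_trans)
  also have "\<dots> \<le> 2 * card F1 + 2 * card F2 + 2 * card F3"
    using B[of fst F1] B[of "fst \<circ> snd" F2] B[of "snd \<circ> snd" F3] F by simp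
  also have "\<dots> < card triples" using F(4) card_triples by simp
  finally have "card all < card triples" .
  moreover have "finite all" unfolding all_def B_def using F by simp
  ultimately have "\<not> triples \<subseteq> all" using card_mono leD by blast
  then obtain i j l where t: "(i, j, l) \<in> triples" "(i, j, l) \<notin> all" by auto
  show thesis
    by (rule that[OF t(1)]) (use t in \<open>auto simp: all_def B_def\<close>)
qed

lemma shift_ne:
  assumes "i \<in> {0, 1, 2, 3, 4, 5 :: int}" "i \<noteq> (p - A) mod 6"
  shows "(A + i) mod 6 \<noteq> p mod 6"
proof
  assume "(A + i) mod 6 = p mod 6"
  then have "(A + i - A) mod 6 = (p - A) mod 6" by (rule mod_diff_cong) simp
  then have "i mod 6 = (p - A) mod 6" by simp
  moreover have "i mod 6 = i" using assms(1) by auto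
  ultimately show False using assms(2) by simp
qed

text \<open>Among the six triples with \<open>j\<close> in {0, 1, 5}, the value 3 occurs twice as
  \<open>i\<close> and twice as \<open>l\<close>, and 1, 2, 4, 5 once each. Two residues barred at
  \<open>i\<close> and one at \<open>l\<close> exclude at most 3 + 2 = 5 of them.\<close>

lemma triple_near:
  obtains i j l where "(i, j, l) \<in> triples" "\<not> far (A + j - A)"
    "(A + i) mod 6 \<noteq> p mod 6" "(A + i) mod 6 \<noteq> q mod 6" "(A + l) mod 6 \<noteq> r mod 6"
proof -
  have "\<forall>p\<in>{0, 1, 2, 3, 4, 5 :: int}. \<forall>q\<in>{0, 1, 2, 3, 4, 5 :: int}. \<forall>r\<in>{0, 1, 2, 3, 4, 5 :: int}.
      \<exists>t\<in>triples. fst (snd t) \<in> {0, 1, 5} \<and> fst t \<noteq> p \<and> fst t \<noteq> q \<and> snd (snd t) \<noteq> r"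
    unfolding triples_def by code_simp
  from bspec[OF bspec[OF bspec[OF this mod_6_cases[of "p - A"]] mod_6_cases[of "q - A"]]
      mod_6_cases[of "r - A"]]
  obtain i j l where t: "(i, j, l) \<in> triples" "j \<in> {0, 1, 5}"
    "i \<noteq> (p - A) mod 6" "i \<noteq> (q - A) mod 6" "l \<noteq> (r - A) mod 6"
    by (metis prod.collapse)
  note tp = triples_props[OF t(1)]
  have "\<not> far j" using t(2) by (auto simp: far_def)
  then show thesis
    using that[OF t(1)] shift_ne[OF tp(4) t(3)] shift_ne[OF tp(4) t(4)] shift_ne[OF tp(6) t(5)] by simp
qed

text \<open>The exception in offsets from A: if 0 is barred at \<open>j\<close>, then
  \<open>j\<close> is 1 or 5, and every triple with this \<open>j\<close> also uses 3, at
  \<open>i\<close> or at \<open>l\<close>. Barring 3 at both places leaves nothing.\<close>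

lemma triple_near':
  assumes "\<not> (p mod 6 = A mod 6 \<and> (q + 3) mod 6 = A mod 6 \<and> (r + 3) mod 6 = A mod 6)"
  obtains i j l where "(i, j, l) \<in> triples" "\<not> far (A + j - A)" "(A + j) mod 6 \<noteq> p mod 6"
    "(A + i) mod 6 \<noteq> q mod 6" "(A + l) mod 6 \<noteq> r mod 6"
proof -
  have "\<forall>p\<in>{0, 1, 2, 3, 4, 5 :: int}. \<forall>q\<in>{0, 1, 2, 3, 4, 5 :: int}. \<forall>r\<in>{0, 1, 2, 3, 4, 5 :: int}.
      (p = 0 \<and> q = 3 \<and> r = 3) \<or>
      (\<exists>t\<in>triples. fst (snd t) \<in> {0, 1, 5} \<and> fst (snd t) \<noteq> p \<and> fst t \<noteq> q \<and> snd (snd t) \<noteq> r)"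
    unfolding triples_def by code_simp
  note all = bspec[OF bspec[OF bspec[OF this mod_6_cases[of "p - A"]] mod_6_cases[of "q - A"]]
      mod_6_cases[of "r - A"]]
  have s3: "(z + 3) mod 6 = A mod 6" if "(z - A) mod 6 = 3" for z
    using mod_add_cong[of "z - A" 6 3 "A + 3" "A + 3"] that by (simp add: algebra_simps)
  have s0: "z mod 6 = A mod 6" if "(z - A) mod 6 = 0" for z
    using that by (simp add: mod_eq_dvd_iff dvd_eq_mod_eq_0)
  have "\<not> ((p - A) mod 6 = 0 \<and> (q - A) mod 6 = 3 \<and> (r - A) mod 6 = 3)"
    using assms s3[of q] s3[of r] s0[of p] by metis
  with all obtain i j l where t: "(i, j, l) \<in> triples" "j \<in> {0, 1, 5}"
    "j \<noteq> (p - A) mod 6" "i \<noteq> (q - A) mod 6" "l \<noteq> (r - A) mod 6"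
    by (metis prod.collapse)
  note tp = triples_props[OF t(1)]
  have "\<not> far j" using t(2) by (auto simp: far_def)
  then show thesis
    using that[OF t(1)] shift_ne[OF tp(5) t(3)] shift_ne[OF tp(4) t(4)] shift_ne[OF tp(6) t(5)] by simp
qed

text \<open>If A and B agree, \<open>i\<close> and \<open>j\<close> must be the offsets 1 and 5 in
  some order, because 0 is the only even offset in the interval. This forces \<open>l\<close> to be
  3.\<close>

lemma triple_near_near:
  assumes "\<not> (B mod 6 = A mod 6 \<and> (r + 3) mod 6 = A mod 6)"
  obtains i j l where "(i, j, l) \<in> triples" "\<not> far (A + j - A)" "\<not> far (A + i - B)"
    "(A + l) mod 6 \<noteq> r mod 6"
proof -
  have "\<forall>b\<in>{0, 1, 2, 3, 4, 5 :: int}. \<forall>r\<in>{0, 1, 2, 3, 4, 5 :: int}.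
      (b = 0 \<and> r = 3) \<or>
      (\<exists>t\<in>triples. fst (snd t) \<in> {0, 1, 5} \<and> (fst t - b) mod 6 \<in> {0, 1, 5} \<and> snd (snd t) \<noteq> r)"
    unfolding triples_def by code_simp
  note all = bspec[OF bspec[OF this mod_6_cases[of "B - A"]] mod_6_cases[of "r - A"]]
  have s3: "(z + 3) mod 6 = A mod 6" if "(z - A) mod 6 = 3" for z
    using mod_add_cong[of "z - A" 6 3 "A + 3" "A + 3"] that by (simp add: algebra_simps)
  have s0: "z mod 6 = A mod 6" if "(z - A) mod 6 = 0" for z
    using that by (simp add: mod_eq_dvd_iff dvd_eq_mod_eq_0)
  have "\<not> ((B - A) mod 6 = 0 \<and> (r - A) mod 6 = 3)" using assms s3[of r] s0[of B] by metis
  with all obtain i j l where t: "(i, j, l) \<in> triples" "j \<in> {0, 1, 5}"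
    "(i - (B - A) mod 6) mod 6 \<in> {0, 1, 5}" "l \<noteq> (r - A) mod 6"
    by (metis prod.collapse)
  note tp = triples_props[OF t(1)]
  have "\<not> far j" using t(2) by (auto simp: far_def)
  moreover have "(A + i - B) mod 6 = (i - (B - A) mod 6) mod 6"
    by (simp add: mod_diff_right_eq algebra_simps)
  then have "\<not> far (A + i - B)" using t(3) unfolding far_def by auto
  ultimately show thesis using that[OF t(1)] shift_ne[OF tp(6) t(4)] by simp
qed

lemma center_not: "center a (\<not> s) mod 6 = (center a s + 3) mod 6"
  unfolding center_def by (cases s) (simp_all add: algebra_simps)

lemma center_far: "far (center k h - center a s) = far (k - center a (h \<noteq> s))"
  using far_center_diff[of k h a s] far_center_diff[of k False a "h \<noteq> s"]
  unfolding center_def by auto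

lemma center_cong: "center k h mod 6 = center a s mod 6 \<longleftrightarrow> k mod 6 = center a (h \<noteq> s) mod 6"
proof -
  have *: "(k + 3) mod 6 = (a + 3) mod 6 \<longleftrightarrow> k mod 6 = a mod 6" for k a :: int
    by (simp add: mod_eq_dvd_iff)
  have "(k + 3) mod 6 = (a + 3 + 3) mod 6 \<longleftrightarrow> k mod 6 = (a + 3) mod 6"
    by (rule *)
  then have **: "(k + 3) mod 6 = a mod 6 \<longleftrightarrow> k mod 6 = (a + 3) mod 6"
    by (simp add: add.assoc)
  show ?thesis using * ** unfolding center_def by (cases h; cases s) auto
qed

lemma pot_clique:
  assumes "finite K" "\<And>a b. a \<in> K \<Longrightarrow> b \<in> K \<Longrightarrow> a \<noteq> b \<Longrightarrow> adj a b" "\<And>a. \<not> adj a a"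
  shows "pot adj K = int (card K) * (4 - int (card K))"
proof -
  have "card (nb adj K a) = card K - 1" if "a \<in> K" for a
  proof -
    have "nb adj K a = K - {a}" using assms(2,3) that unfolding nb_def by auto
    then show ?thesis using that by simp
  qed
  then have "links adj K K = card K * (card K - 1)" unfolding links_def by simp
  then have "int (links adj K K) = int (card K) * (int (card K) - 1)"
    by (cases "card K") (simp_all add: algebra_simps)
  then show ?thesis unfolding pot_def by (simp add: algebra_simps)
qed

text \<open>For k vertices the value is 4 - (k - 2)^2, so only a single edge reaches 4.\<close>

lemma pot_clique_le_4:
  fixes K :: "'v set"
  assumes "finite K" "\<And>a b. a \<in> K \<Longrightarrow> b \<in> K \<Longrightarrow> a \<noteq> b \<Longrightarrow> adj a b" "\<And>a. \<not> adj a a"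
  shows "pot adj K \<le> 4" "pot adj K = 4 \<Longrightarrow> card K = 2"
proof -
  define k where "k = int (card K)"
  have p: "pot adj K = 4 - (k - 2)\<^sup>2"
    using pot_clique[where adj = adj, OF assms] unfolding k_def by (simp add: power2_eq_square algebra_simps)
  then show "pot adj K \<le> 4" by simp
  assume "pot adj K = 4"
  then have "k = 2" using p by simp
  then show "card K = 2" unfolding k_def by simp
qed

section \<open>Local structure around a triangle with a type A vertex\<close>

locale bad_triangle = minimal_counterexample V adj sg
  for V :: "'v set" and adj sg +
  fixes x y v :: 'v
  assumes A: "badA v" and sv: "strong v = {x, y}" and xy: "x \<noteq> y"
begin

abbreviation "T \<equiv> {x, y, v}"

lemma vertices: "x \<in> V - D2" "y \<in> V - D2" "v \<in> V - D2" "x \<noteq> v" "y \<noteq> v"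
  using A strongD[of x v] strongD[of y v] sv unfolding badA_def by auto

lemma edges: "adj v x" "adj x v" "adj v y" "adj y v" "adj x y" "adj y x"
  and tri_sign: "sg x y = (sg x v = sg y v)"
  using badA_triangle[OF A sv xy] strongD[of x v] strongD[of y v] sv adj_commute by auto

lemma strong_mem: "y \<in> strong x" "v \<in> strong x" "x \<in> strong y" "v \<in> strong y"
  using vertices edges in_N unfolding strong_def by auto

lemma pot_T: "pot adj T \<le> 3"
proof -
  have "pot adj {v} \<le> pot adj {} + 3 - 2 * int 0"
    by (rule pot_insert_le[OF _ _ ss, of _ _ "{}"]) auto
  moreover have "pot adj {y, v} \<le> pot adj {v} + 3 - 2 * int 1"
    by (rule pot_insert_le[OF _ _ ss, of _ _ "{v}"]) (use vertices edges in \<open>auto simp: nb_def\<close>)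
  moreover have "pot adj {x, y, v} \<le> pot adj {y, v} + 3 - 2 * int 2"
    by (rule pot_insert_le[OF _ _ ss, of _ _ "{y, v}"]) (use vertices edges xy in \<open>auto simp: nb_def\<close>)
  ultimately show ?thesis by simp
qed

text \<open>With such a \<open>z\<close> the four vertices have potential at most 2, so they are all
  of V and \<open>z\<close> is the weak neighbour of \<open>v\<close>. As \<open>x\<close> and
  \<open>y\<close> have degree at least three, \<open>z\<close> is adjacent to the whole triangle,
  against its degree two.\<close>

lemma no_two:
  assumes z: "z \<in> V - T" and ab: "a \<in> T" "b \<in> T" "a \<noteq> b" "adj z a" "adj z b"
  shows False
proof -
  have "pot adj (insert z T) \<le> pot adj T + 3 - 2 * int 2"
    by (rule pot_insert_le[OF _ _ ss, of _ _ "{a, b}"]) (use z ab in \<open>auto simp: nb_def\<close>)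
  then have p: "pot adj (insert z T) \<le> 2" using pot_T by simp
  have "card (insert z T) = 4" using z vertices xy by auto
  moreover have "insert z T \<subseteq> V" using z vertices by auto
  ultimately have V: "V = insert z T" using p pot_ge_3[of "insert z T"] by (auto simp: psubset_eq)
  obtain u where u: "weak v = {u}" using A unfolding badA_def by (auto simp: card_1_singleton_iff)
  then have "u \<in> V" "u \<in> D2" "adj v u" unfolding weak_def nb_def by auto
  then have uz: "u = z" using V vertices by auto
  have "z \<in> N a" if "a \<in> {x, y}" for a
  proof (rule ccontr)
    assume "z \<notin> N a"
    have "N a \<subseteq> T - {a}"
    proof
      fix w assume w: "w \<in> N a"
      then have "w \<in> V" "w \<noteq> a" "w \<noteq> z" using in_N[of w a] \<open>z \<notin> N a\<close> by auto
      moreover have "V \<subseteq> insert z T" using V by (rule equalityD1)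
      ultimately show "w \<in> T - {a}" by blast
    qed
    then have "card (N a) \<le> card (T - {a})" by (intro card_mono) auto
    moreover have "card (T - {a}) = 2" using that vertices xy by auto
    moreover have "card (N a) \<ge> 3" using deg_ge_3[of a] card_N[of a] that vertices by auto
    ultimately show False by simp
  qed
  then have "T \<subseteq> N z" using \<open>adj v u\<close> uz vertices adj_commute in_N by auto
  then have "card T \<le> card (N z)" by (intro card_mono) auto
  moreover have "card T = 3" using vertices xy by simp
  ultimately show False using \<open>u \<in> D2\<close> uz unfolding D2_def by simp
qed

definition "U = weak x \<union> weak y \<union> weak v"

definition "S = V - (T \<union> U)"

text \<open>Adding 3 to the colours of \<open>x\<close> and \<open>y\<close> where \<open>shift\<close> holds makes all three edges of the triangle
  positive; \<open>strong_val\<close> and \<open>weak_val\<close> are the centers and the forbidden residues in these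
  normalized colours.\<close>

definition "shift z \<longleftrightarrow> (z = x \<and> \<not> sg x v) \<or> (z = y \<and> \<not> sg y v)"

definition strong_val :: "('v \<Rightarrow> int) \<Rightarrow> 'v \<Rightarrow> 'v \<Rightarrow> int" where
  "strong_val f z a = center (f a) (shift z \<noteq> sg a z)"

definition weak_val :: "('v \<Rightarrow> int) \<Rightarrow> 'v \<Rightarrow> 'v \<Rightarrow> int" where
  "weak_val f z u = center (f (oth u z)) (shift z \<noteq> (sg u z = sg u (oth u z)))"

lemma U_D2: "U \<subseteq> D2"
  unfolding U_def weak_def by blast

lemma weak_out:
  assumes "z \<in> T" "u \<in> weak z"
  shows "oth u z \<in> S" "u \<in> V - T" "\<And>a. a \<in> T \<Longrightarrow> adj u a \<Longrightarrow> a = z" "adj u z" "adj u (oth u z)"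
    "N u = {z, oth u z}"
proof -
  have z: "z \<in> V - D2" using assms vertices by auto
  note n = weak_oth[OF z assms(2)]
  show uT: "u \<in> V - T" using n vertices by auto
  show one: "a = z" if "a \<in> T" "adj u a" for a
    using no_two[OF uT that(1) assms(1)] that n by blast
  show "oth u z \<in> S"
    using one[of "oth u z"] n U_D2 unfolding S_def by blast
  show "adj u z" "adj u (oth u z)" "N u = {z, oth u z}" using n by auto
qed

lemma strong_out:
  assumes "z \<in> T" "a \<in> strong z - T"
  shows "a \<in> S" "\<And>b. b \<in> T \<Longrightarrow> adj a b \<Longrightarrow> b = z" "adj a z"
proof -
  note n = strongD[of a z]
  show "a \<in> S" using n assms U_D2 unfolding S_def by blast
  show "b = z" if "b \<in> T" "adj a b" for b
    using no_two[of a b z] that n assms by blast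
  show "adj a z" using n assms by blast
qed

text \<open>The normalized colours are a common base \<open>k\<close> plus a triple. By
  \<open>no_two\<close> every outside neighbour belongs to one corner only, so the remaining
  conditions concern each corner separately.\<close>

lemma recolor_triangle:
  assumes f: "good adj sg f S" and ijl: "(i, j, l) \<in> triples"
    and sx: "\<And>a. a \<in> strong x - T \<Longrightarrow> \<not> far (k + i - strong_val f x a)"
    and sy: "\<And>a. a \<in> strong y - T \<Longrightarrow> \<not> far (k + j - strong_val f y a)"
    and wx: "\<And>u. u \<in> weak x \<Longrightarrow> (k + i) mod 6 \<noteq> weak_val f x u mod 6"
    and wy: "\<And>u. u \<in> weak y \<Longrightarrow> (k + j) mod 6 \<noteq> weak_val f y u mod 6"
    and wv: "\<And>u. u \<in> weak v \<Longrightarrow> (k + l) mod 6 \<noteq> weak_val f v u mod 6"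
  shows False
proof -
  define c0 where "c0 z = k + (if z = x then i else if z = y then j else l)" for z
  define c where "c z = center (c0 z) (shift z)" for z
  have c0: "c0 x = k + i" "c0 y = k + j" "c0 v = k + l" using vertices xy unfolding c0_def by auto
  have sh: "shift x = (\<not> sg x v)" "shift y = (\<not> sg y v)" "\<not> shift v"
    using vertices xy unfolding shift_def by auto
  show False
  proof (rule recolor[of T f c])
    show "T \<subseteq> V - D2" using vertices by simp
    show "oth u z \<notin> T" if "z \<in> T" "u \<in> weak z" for z u
      using weak_out(1)[OF that] unfolding S_def by blast
    show "good adj sg f (V - (T \<union> \<Union> (weak ` T)))"
      using f unfolding S_def U_def by (simp add: Un_assoc)
    have fr: "far (c0 x - c0 y)" "far (c0 x - c0 v)" "far (c0 y - c0 v)"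
      using triples_props[OF ijl] c0 by (simp_all add: algebra_simps)
    have "far (c x - c y) = sg x y" "far (c x - c v) = sg x v" "far (c y - c v) = sg y v"
      using fr sh tri_sign unfolding c_def far_center_diff by auto
    then show "far (c a - c b) = sg a b" if "a \<in> T" "b \<in> T" "adj a b" for a b
      using that sg_commute far_minus_commute adj_irrefl by (metis empty_iff insert_iff)
    show "far (f a - c z) = sg a z" if "z \<in> T" "a \<in> strong z - T" for z a
    proof -
      have "\<not> far (c0 z - strong_val f z a)" using that c0 sx sy sv by auto
      then show ?thesis unfolding far_eq_iff c_def strong_val_def center_far by blast
    qed
    show "c z mod 6 \<noteq> forb f z u mod 6" if "z \<in> T" "u \<in> weak z" for z u
    proof -
      have "c0 z mod 6 \<noteq> weak_val f z u mod 6" using that c0 wx wy wv by auto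
      then show ?thesis unfolding c_def forb_def weak_val_def center_cong .
    qed
  qed
qed

lemma S_col: obtains f where "good adj sg f S"
  using colorable_proper[of S] vertices unfolding S_def by auto

text \<open>By \<open>add_edge\<close>, two vertices outside whose normalized colours agree in every colouring are joined
  by an edge. When the triangle cannot be recoloured, its outer neighbours therefore form a
  clique, and the potential of this clique with the triangle becomes too small.\<close>

lemma forced_adjacent:
  assumes "a \<in> S" "b \<in> S" "a \<noteq> b"
    and "\<And>f. good adj sg f S \<Longrightarrow> center (f a) s mod 6 = center (f b) t mod 6"
  shows "adj a b"
proof (rule ccontr)
  assume na: "\<not> adj a b"
  obtain f where f: "good adj sg f S" "far (f a - f b) = (s = t)"
    by (rule add_edge[of S x v a b "s = t"]) (use assms vertices na S_def in auto)
  then have "far (center (f a) s - center (f b) t)" unfolding far_center_diff by blast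
  moreover have "(center (f a) s - center (f b) t) mod 6 = 0"
    using assms(4)[OF f(1)] by (simp add: mod_eq_dvd_iff)
  ultimately show False by (simp add: far_def)
qed

section \<open>Excluded neighbourhoods of the triangle\<close>

lemma card_weak_v: obtains u where "weak v = {u}"
  using A unfolding badA_def by (auto simp: card_1_singleton_iff)

text \<open>Without outer strong neighbours only single residues are barred, and
  \<open>triple_avoiding\<close> copes with five of them. One is spent on the weak neighbour of
  \<open>v\<close>.\<close>

lemma weak_sum:
  assumes "strong x \<subseteq> T" "strong y \<subseteq> T"
  shows "card (weak x) + card (weak y) \<ge> 5"
proof (rule ccontr)
  assume a: "\<not> ?thesis"
  obtain u where u: "weak v = {u}" by (rule card_weak_v)
  obtain f where f: "good adj sg f S" by (rule S_col)
  have "card (weak_val f x ` weak x) \<le> card (weak x)" "card (weak_val f y ` weak y) \<le> card (weak y)"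
    by (auto intro: card_image_le)
  then have c5: "card (weak_val f x ` weak x) + card (weak_val f y ` weak y) + card {weak_val f v u} \<le> 5"
    using a by simp
  have fin3: "finite (weak_val f x ` weak x)" "finite (weak_val f y ` weak y)" "finite {weak_val f v u}"
    by simp_all
  obtain i j l where t: "(i, j, l) \<in> triples"
    "\<forall>r\<in>weak_val f x ` weak x. i \<noteq> r mod 6" "\<forall>r\<in>weak_val f y ` weak y. j \<noteq> r mod 6"
    "\<forall>r\<in>{weak_val f v u}. l \<noteq> r mod 6"
    by (rule triple_avoiding[OF fin3 c5])
  have m: "(0 + i) mod 6 = i" "(0 + j) mod 6 = j" "(0 + l) mod 6 = l"
    using triples_props(7-9)[OF t(1)] by simp_all
  show False
  proof (rule recolor_triangle[OF f t(1), of 0], unfold m)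
    show "\<not> far (0 + i - strong_val f x b)" if "b \<in> strong x - T" for b using that assms(1) by blast
    show "\<not> far (0 + j - strong_val f y b)" if "b \<in> strong y - T" for b using that assms(2) by blast
    show "i \<noteq> weak_val f x w mod 6" if "w \<in> weak x" for w using t(2) that by blast
    show "j \<noteq> weak_val f y w mod 6" if "w \<in> weak y" for w using t(3) that by blast
    show "l \<noteq> weak_val f v w mod 6" if "w \<in> weak v" for w using t(4) that[unfolded u] by simp
  qed
qed

lemma not_one_two:
  assumes "strong x \<subseteq> T" "strong y - T = {a}" "card (weak x) \<in> {1, 2}" "weak y = {}"
  shows False
proof -
  obtain u where u: "weak v = {u}" by (rule card_weak_v)
  \<comment> \<open>Here \<open>p = q\<close> if \<open>x\<close> has only one weak
    neighbour.\<close>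
  obtain p q where pq: "weak x = {p, q}" 
    using assms(3) by (auto simp: card_1_singleton_iff card_2_iff)
  obtain f where f: "good adj sg f S" by (rule S_col)
  define k where "k = strong_val f y a"
  obtain i j l where t: "(i, j, l) \<in> triples" "\<not> far (k + j - k)"
    "(k + i) mod 6 \<noteq> weak_val f x p mod 6" "(k + i) mod 6 \<noteq> weak_val f x q mod 6"
    "(k + l) mod 6 \<noteq> weak_val f v u mod 6"
    by (rule triple_near)
  show False
  proof (rule recolor_triangle[OF f t(1), of "k"])
    show "\<not> far (k + i - strong_val f x b)" if "b \<in> strong x - T" for b using that assms(1) by blast
    show "\<not> far (k + j - strong_val f y b)" if "b \<in> strong y - T" for b using that[unfolded assms(2)] t(2) unfolding k_def by simp
    show "(k + i) mod 6 \<noteq> weak_val f x w mod 6" if "w \<in> weak x" for w using that[unfolded pq] t(3,4) by (metis insertE singletonD)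
    show "(k + j) mod 6 \<noteq> weak_val f y w mod 6" if "w \<in> weak y" for w using that assms(4) by blast
    show "(k + l) mod 6 \<noteq> weak_val f v w mod 6" if "w \<in> weak v" for w using that[unfolded u] t(5) by simp
  qed
qed

text \<open>The one exception of \<open>triple_near'\<close> must occur in every colouring of
  \<open>S\<close>, so the outer vertices form a clique. Counting potential shows that V is this
  clique, the triangle and three weak vertices, and that the clique is a single edge. Its end
  \<open>n\<close> then needs all three weak vertices, which leaves \<open>a\<close> with degree at
  most two.\<close>

lemma not_one_one_one:
  assumes sx: "strong x \<subseteq> T" and sy: "strong y - T = {a}" and wx: "weak x = {p}" and wy: "weak y = {q}"
  shows False
proof -
  obtain u where u: "weak v = {u}" by (rule card_weak_v)
  define bx bq bv where "bx = oth p x" and "bq = oth q y" and "bv = oth u v"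
  have op: "bx \<in> S" "p \<in> V - T" "adj p x" "adj p bx" "N p = {x, bx}"
    using weak_out(1,2,4-6)[of x p] wx unfolding bx_def by simp_all
  have oq: "bq \<in> S" "q \<in> V - T" "adj q y" "adj q bq" "N q = {y, bq}"
    using weak_out(1,2,4-6)[of y q] wy unfolding bq_def by simp_all
  have ou: "bv \<in> S" "u \<in> V - T" "adj u v" "adj u bv" "N u = {v, bv}"
    using weak_out(1,2,4-6)[of v u] u unfolding bv_def by simp_all
  have sy_a: "a \<in> strong y - T" using sy by simp
  have oa: "a \<in> S" "adj a y" using strong_out(1,3)[OF _ sy_a] by simp_all
  \<comment> \<open>In the exception the residues barred at \<open>x\<close> and \<open>v\<close>
    are antipodal to the centre at \<open>y\<close>. Negating \<open>sp\<close> and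
    \<open>su\<close> turns this into agreement of all four values.\<close>
  define sa sq sp su where "sa = (shift y \<noteq> sg a y)" and "sq = (shift y \<noteq> (sg q y = sg q bq))"
    and "sp = (\<not> (shift x \<noteq> (sg p x = sg p bx)))" and "su = (\<not> (shift v \<noteq> (sg u v = sg u bv)))"
  have forced: "center (f bq) sq mod 6 = center (f a) sa mod 6 \<and>
      center (f bx) sp mod 6 = center (f a) sa mod 6 \<and> center (f bv) su mod 6 = center (f a) sa mod 6"
    if f: "good adj sg f S" for f
  proof (rule ccontr)
    assume n: "\<not> ?thesis"
    have "strong_val f y a = center (f a) sa" "weak_val f y q = center (f bq) sq"
      "(weak_val f x p + 3) mod 6 = center (f bx) sp mod 6"
      "(weak_val f v u + 3) mod 6 = center (f bv) su mod 6"
      unfolding strong_val_def weak_val_def sa_def sq_def sp_def su_def center_not bx_def bq_def bv_def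
      by simp_all
    with n have "\<not> (weak_val f y q mod 6 = strong_val f y a mod 6 \<and>
        (weak_val f x p + 3) mod 6 = strong_val f y a mod 6 \<and>
        (weak_val f v u + 3) mod 6 = strong_val f y a mod 6)" by metis
    from triple_near'[OF this] obtain i j l where t: "(i, j, l) \<in> triples"
      "\<not> far (strong_val f y a + j - strong_val f y a)"
      "(strong_val f y a + j) mod 6 \<noteq> weak_val f y q mod 6"
      "(strong_val f y a + i) mod 6 \<noteq> weak_val f x p mod 6"
      "(strong_val f y a + l) mod 6 \<noteq> weak_val f v u mod 6" by metis
    show False
    proof (rule recolor_triangle[OF f t(1), of "strong_val f y a"])
      show "\<not> far (strong_val f y a + i - strong_val f x b)" if "b \<in> strong x - T" for b using that sx by blast
      show "\<not> far (strong_val f y a + j - strong_val f y b)" if "b \<in> strong y - T" for b using that[unfolded sy] t(2) by simp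
      show "(strong_val f y a + i) mod 6 \<noteq> weak_val f x w mod 6" if "w \<in> weak x" for w using that[unfolded wx] t(4) by simp
      show "(strong_val f y a + j) mod 6 \<noteq> weak_val f y w mod 6" if "w \<in> weak y" for w using that[unfolded wy] t(3) by simp
      show "(strong_val f y a + l) mod 6 \<noteq> weak_val f v w mod 6" if "w \<in> weak v" for w using that[unfolded u] t(5) by simp
    qed
  qed
  define K where "K = {a, bq, bx, bv}"
  \<comment> \<open>The four vertices may coincide; where they do, any of their values serves, since
    all agree with the one at \<open>a\<close>.\<close>
  define bit where "bit z = (if z = a then sa else if z = bq then sq else if z = bx then sp else su)" for z
  have KS: "K \<subseteq> S" using op oq ou oa unfolding K_def by simp
  have cl: "adj b c" if bc: "b \<in> K" "c \<in> K" "b \<noteq> c" for b c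
  proof (rule forced_adjacent[of b c "bit b" "bit c"])
    show "center (f b) (bit b) mod 6 = center (f c) (bit c) mod 6" if "good adj sg f S" for f
    proof -
      have "center (f d) (bit d) mod 6 = center (f a) sa mod 6" if "d \<in> K" for d
        using that forced[OF \<open>good adj sg f S\<close>] unfolding K_def bit_def by auto
      then show ?thesis using bc by metis
    qed
  qed (use bc KS in auto)
  have fK: "finite K" unfolding K_def by simp
  note p4 = pot_clique_le_4[where adj = adj, OF fK cl adj_irrefl]
  have dist: "p \<noteq> q" "p \<noteq> u" "q \<noteq> u" 
  proof -
    have pq: "p \<in> weak x" "q \<in> weak y" using wx wy by simp_all
    have "\<not> adj p y" "\<not> adj p v" "\<not> adj q v"
      using weak_out(3)[OF _ pq(1), of y] weak_out(3)[OF _ pq(1), of v] weak_out(3)[OF _ pq(2), of v]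
        xy vertices(4,5) by blast+
    then show "p \<noteq> q" "p \<noteq> u" "q \<noteq> u" using oq(3) ou(3) by metis+
  qed
  have pD: "p \<in> D2" "q \<in> D2" "u \<in> D2" using wx wy u unfolding weak_def by auto
  have uU: "p \<in> U" "q \<in> U" "u \<in> U" using wx wy u unfolding U_def by auto
  have KU: "K \<inter> U = {}" "K \<inter> T = {}" using KS unfolding S_def by auto
  have Tn: "p \<notin> T" "q \<notin> T" "u \<notin> T" using op oq ou by auto
  have aq: "a \<noteq> q" using oa(1) uU unfolding S_def by blast
  define K1 where "K1 = insert p (insert q (insert u K))"
  \<comment> \<open>Each of \<open>u\<close>, \<open>q\<close>, \<open>p\<close> contributes at most
    3 - 2 = 1, and \<open>y\<close>, \<open>x\<close>, \<open>v\<close> at most -1, -1, -3, in total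
    -2. A clique has potential at most 4, so the result is at most 2, too small for a proper
    subset.\<close>
  have "pot adj (insert u K) \<le> pot adj K + 3 - 2 * int 1"
    by (rule pot_insert_le[OF _ _ ss, of _ _ "{bv}"]) (use fK KU uU ou in \<open>auto simp: nb_def K_def\<close>)
  moreover have "pot adj (insert q (insert u K)) \<le> pot adj (insert u K) + 3 - 2 * int 1"
    by (rule pot_insert_le[OF _ _ ss, of _ _ "{bq}"]) (use fK KU uU oq dist in \<open>auto simp: nb_def K_def\<close>)
  moreover have "pot adj K1 \<le> pot adj (insert q (insert u K)) + 3 - 2 * int 1"
    unfolding K1_def
    by (rule pot_insert_le[OF _ _ ss, of _ _ "{bx}"]) (use fK KU uU op dist in \<open>auto simp: nb_def K_def\<close>)
  moreover have "pot adj (insert y K1) \<le> pot adj K1 + 3 - 2 * int 2"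
    by (rule pot_insert_le[OF _ _ ss, of _ _ "{a, q}"])
      (use fK KU uU oa oq aq adj_commute Tn in \<open>auto simp: nb_def K_def K1_def\<close>)
  moreover have "pot adj (insert x (insert y K1)) \<le> pot adj (insert y K1) + 3 - 2 * int 2"
    by (rule pot_insert_le[OF _ _ ss, of _ _ "{y, p}"])
      (use fK KU op adj_commute Tn xy edges in \<open>auto simp: nb_def K1_def\<close>)
  moreover have "pot adj (insert v (insert x (insert y K1))) \<le> pot adj (insert x (insert y K1)) + 3 - 2 * int 3"
    by (rule pot_insert_le[OF _ _ ss, of _ _ "{x, y, u}"])
      (use fK KU ou adj_commute Tn xy vertices edges in \<open>auto simp: nb_def K1_def\<close>)
  ultimately have pW: "pot adj (insert v (insert x (insert y K1))) \<le> pot adj K - 2" by simp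
  define W where "W = insert v (insert x (insert y K1))"
  have WV: "W \<subseteq> V" using KS op oq ou vertices unfolding W_def K1_def S_def by auto
  have "card {v, x, y, p} \<le> card W" using fK unfolding W_def K1_def by (intro card_mono) auto
  moreover have "card {v, x, y, p} = 4" using vertices xy Tn by auto
  ultimately have c4: "card W \<ge> 4" by simp
  have VW: "V = W"
    using pot_ge_3[of W] WV c4 pW p4(1) unfolding W_def[symmetric] by (auto simp: psubset_eq)
  then have "pot adj K = 4" using big pW p4(1) unfolding W_def[symmetric] by simp
  then have "card K = 2" using p4(2) by simp
  moreover have "a \<in> K" unfolding K_def by simp
  ultimately obtain n where n: "K = {a, n}" "n \<noteq> a" by (auto simp: card_2_iff)
  have nV: "n \<in> V - D2" "a \<in> V - D2"
  proof -
    have "z \<notin> D2" if "z \<in> K" for z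
    proof -
      consider "z = a" | "z = bq" | "z = bx" | "z = bv" using \<open>z \<in> K\<close> unfolding K_def by blast
      then show ?thesis
      proof cases
        case 1 then show ?thesis using strongD[of a y] sy by blast
      next
        case 2 then show ?thesis using weak_oth(3)[of y q] vertices wy unfolding bq_def by auto
      next
        case 3 then show ?thesis using weak_oth(3)[of x p] vertices wx unfolding bx_def by auto
      next
        case 4 then show ?thesis using weak_oth(3)[of v u] vertices u unfolding bv_def by auto
      qed
    qed
    then show "n \<in> V - D2" "a \<in> V - D2" using KS n unfolding S_def by auto
  qed
  have VL: "V = {v, x, y, p, q, u, a, n}" using VW n unfolding W_def K1_def by auto
  have nT: "\<not> adj n z" if "z \<in> T" for z
  proof
    assume az: "adj n z"
    have "n \<in> strong z - T" using nV az KU n adj_commute in_N unfolding strong_def by auto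
    then show False using that sx sy sv n(2) by auto
  qed
  have "strong n \<subseteq> {a}"
  proof
    fix z assume z: "z \<in> strong n"
    then have "z \<in> V" "z \<notin> D2" "adj n z" "z \<noteq> n" using strongD[OF z] by auto
    then show "z \<in> {a}" using VL nT pD by auto
  qed
  moreover have "weak n \<subseteq> {p, q, u}"
  proof
    fix z assume "z \<in> weak n"
    then have "z \<in> V" "z \<in> D2" unfolding weak_def nb_def by auto
    then show "z \<in> {p, q, u}" using VL vertices nV by auto
  qed
  moreover have "strong n = {} \<or> strong n = {a}" using calculation(1) by blast
  then have "card (weak n) \<ge> 3" using weak_ge_6[OF nV(1)] weak_ge_3[OF nV(1), of a] by auto
  moreover have "card {p, q, u} = 3" using dist by simp
  ultimately have "weak n = {p, q, u}" by (intro card_seteq) auto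
  then have nad: "adj p n" "adj q n" "adj u n" using adj_commute unfolding weak_def nb_def by auto
  have "N a \<subseteq> {n, y}"
  proof
    fix z assume z: "z \<in> N a"
    then have z': "z \<in> V" "adj a z" "z \<noteq> a" using in_N by auto
    have "z \<notin> {p, q, u}"
    proof
      assume zz: "z \<in> {p, q, u}"
      then obtain t t' where t: "t \<in> T" "N z = {t, t'}" using op(5) oq(5) ou(5) by blast
      have "a \<in> N z" "n \<in> N z" "n \<notin> T" "a \<notin> T"
        using zz nad z' adj_commute nV in_N KU n by auto
      then show False using t n(2) by auto
    qed
    moreover have "z \<noteq> x" "z \<noteq> v" 
      using z' strong_out(2)[OF _ sy_a] vertices xy by auto
    ultimately show "z \<in> {n, y}" using z' VL by auto
  qed
  then have "card (N a) \<le> card {n, y}" by (intro card_mono) auto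
  then have "card (N a) \<le> 2" using card_insert_le_m1[of 2 "{y}" n] by simp
  then show False using deg_ge_3[OF nV(2)] card_N[of a] by simp
qed

text \<open>The exception of \<open>triple_near_near\<close> makes \<open>a\<close>,
  \<open>b\<close>, \<open>bv\<close> a clique, again a single edge by potential. Its two vertices
  share the three attachments to \<open>y\<close>, \<open>x\<close> and \<open>u\<close>, so one of
  them has only one attachment and degree at most two.\<close>

lemma not_two_strong:
  assumes sx: "strong x - T = {b}" and sy: "strong y - T = {a}" and wx: "weak x = {}" and wy: "weak y = {}"
  shows False
proof -
  obtain u where u: "weak v = {u}" by (rule card_weak_v)
  define bv where "bv = oth u v"
  have ou: "bv \<in> S" "u \<in> V - T" "adj u v" "adj u bv" "N u = {v, bv}"
    using weak_out(1,2,4-6)[of v u] u unfolding bv_def by simp_all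
  have sy_a: "a \<in> strong y - T" and sx_b: "b \<in> strong x - T" using sy sx by simp_all
  have oa: "a \<in> S" "adj a y" using strong_out(1,3)[OF _ sy_a] by simp_all
  have ob: "b \<in> S" "adj b x" using strong_out(1,3)[OF _ sx_b] by simp_all
  define sa sb su where "sa = (shift y \<noteq> sg a y)" and "sb = (shift x \<noteq> sg b x)"
    and "su = (\<not> (shift v \<noteq> (sg u v = sg u bv)))"
  have forced: "center (f b) sb mod 6 = center (f a) sa mod 6 \<and>
      center (f bv) su mod 6 = center (f a) sa mod 6"
    if f: "good adj sg f S" for f
  proof (rule ccontr)
    assume n: "\<not> ?thesis"
    have "strong_val f y a = center (f a) sa" "strong_val f x b = center (f b) sb"
      "(weak_val f v u + 3) mod 6 = center (f bv) su mod 6"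
      unfolding strong_val_def weak_val_def sa_def sb_def su_def center_not bv_def
      by simp_all
    with n have "\<not> (strong_val f x b mod 6 = strong_val f y a mod 6 \<and>
        (weak_val f v u + 3) mod 6 = strong_val f y a mod 6)" by metis
    from triple_near_near[OF this] obtain i j l where t: "(i, j, l) \<in> triples"
      "\<not> far (strong_val f y a + j - strong_val f y a)"
      "\<not> far (strong_val f y a + i - strong_val f x b)"
      "(strong_val f y a + l) mod 6 \<noteq> weak_val f v u mod 6" by metis
    show False
    proof (rule recolor_triangle[OF f t(1), of "strong_val f y a"])
      show "\<not> far (strong_val f y a + i - strong_val f x b)" if "b \<in> strong x - T" for b using that[unfolded sx] t(3) by simp
      show "\<not> far (strong_val f y a + j - strong_val f y b)" if "b \<in> strong y - T" for b using that[unfolded sy] t(2) by simp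
      show "(strong_val f y a + i) mod 6 \<noteq> weak_val f x w mod 6" if "w \<in> weak x" for w using that wx by blast
      show "(strong_val f y a + j) mod 6 \<noteq> weak_val f y w mod 6" if "w \<in> weak y" for w using that wy by blast
      show "(strong_val f y a + l) mod 6 \<noteq> weak_val f v w mod 6" if "w \<in> weak v" for w using that[unfolded u] t(4) by simp
    qed
  qed
  define K where "K = {a, b, bv}"
  define bit where "bit z = (if z = a then sa else if z = b then sb else su)" for z
  have KS: "K \<subseteq> S" using ob ou oa unfolding K_def by simp
  have cl: "adj d c" if dc: "d \<in> K" "c \<in> K" "d \<noteq> c" for d c
  proof (rule forced_adjacent[of d c "bit d" "bit c"])
    show "center (f d) (bit d) mod 6 = center (f c) (bit c) mod 6" if "good adj sg f S" for f
    proof -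
      have "center (f e) (bit e) mod 6 = center (f a) sa mod 6" if "e \<in> K" for e
        using that forced[OF \<open>good adj sg f S\<close>] unfolding K_def bit_def by auto
      then show ?thesis using dc by metis
    qed
  qed (use dc KS in auto)
  have fK: "finite K" unfolding K_def by simp
  note p4 = pot_clique_le_4[where adj = adj, OF fK cl adj_irrefl]
  have uD: "u \<in> D2" using u unfolding weak_def by auto
  have uU: "u \<in> U" using u unfolding U_def by auto
  have KU: "K \<inter> U = {}" "K \<inter> T = {}" using KS unfolding S_def by auto
  have Tn: "u \<notin> T" using ou by auto
  define K1 where "K1 = insert u K"
  \<comment> \<open>The four additions contribute at most 1, 1, -1 and -3; \<open>y\<close> is
    counted with its edge to \<open>a\<close> alone.\<close>
  have "pot adj K1 \<le> pot adj K + 3 - 2 * int 1"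
    unfolding K1_def
    by (rule pot_insert_le[OF _ _ ss, of _ _ "{bv}"]) (use fK KU uU ou in \<open>auto simp: nb_def K_def\<close>)
  moreover have "pot adj (insert y K1) \<le> pot adj K1 + 3 - 2 * int 1"
    by (rule pot_insert_le[OF _ _ ss, of _ _ "{a}"])
      (use fK KU oa adj_commute Tn in \<open>auto simp: nb_def K_def K1_def\<close>)
  moreover have "pot adj (insert x (insert y K1)) \<le> pot adj (insert y K1) + 3 - 2 * int 2"
    by (rule pot_insert_le[OF _ _ ss, of _ _ "{y, b}"])
      (use fK KU ob adj_commute Tn xy edges in \<open>auto simp: nb_def K_def K1_def\<close>)
  moreover have "pot adj (insert v (insert x (insert y K1))) \<le> pot adj (insert x (insert y K1)) + 3 - 2 * int 3"
    by (rule pot_insert_le[OF _ _ ss, of _ _ "{x, y, u}"])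
      (use fK KU ou adj_commute Tn xy vertices edges in \<open>auto simp: nb_def K1_def\<close>)
  ultimately have pW: "pot adj (insert v (insert x (insert y K1))) \<le> pot adj K - 2" by simp
  define W where "W = insert v (insert x (insert y K1))"
  have WV: "W \<subseteq> V" using KS ou vertices unfolding W_def K1_def S_def by auto
  have "card {v, x, y, u} \<le> card W" using fK unfolding W_def K1_def by (intro card_mono) auto
  moreover have "card {v, x, y, u} = 4" using vertices xy Tn by auto
  ultimately have c4: "card W \<ge> 4" by simp
  have VW: "V = W"
    using pot_ge_3[of W] WV c4 pW p4(1) unfolding W_def[symmetric] by (auto simp: psubset_eq)
  then have "pot adj K = 4" using big pW p4(1) unfolding W_def[symmetric] by simp
  then have "card K = 2" using p4(2) by simp
  have KD: "z \<in> V - D2" if "z \<in> K" for z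
  proof -
    consider "z = a" | "z = b" | "z = bv" using \<open>z \<in> K\<close> unfolding K_def by blast
    then show ?thesis
    proof cases
      case 1 then show ?thesis using strongD[of a y] sy by blast
    next
      case 2 then show ?thesis using strongD[of b x] sx by blast
    next
      case 3 then show ?thesis using weak_oth(3)[of v u] vertices u unfolding bv_def by auto
    qed
  qed
  have VL: "V = {v, x, y, u} \<union> K" using VW unfolding W_def K1_def by auto
  have nbK: "N z \<subseteq> (K - {z}) \<union> (if z = a then {y} else {}) \<union> (if z = b then {x} else {})
      \<union> (if z = bv then {u} else {})" if z: "z \<in> K" for z
  proof
    fix w assume "w \<in> N z"
    then have w: "w \<in> V" "adj z w" "adj w z" "w \<noteq> z" using in_N adj_commute by auto
    have zT: "z \<notin> T" "z \<notin> U" using z KU by auto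
    have str: "z \<in> strong w" if "w \<in> T" using that w KD[OF z] in_N unfolding strong_def by auto
    consider "w \<in> K" | "w = v" | "w = x" | "w = y" | "w = u" using VL w by blast
    then show "w \<in> (K - {z}) \<union> (if z = a then {y} else {}) \<union> (if z = b then {x} else {})
      \<union> (if z = bv then {u} else {})"
    proof cases
      case 2 then show ?thesis using str sv zT by auto
    next
      case 3 then show ?thesis using str sx zT by auto
    next
      case 4 then show ?thesis using str sy zT by auto
    next
      case 5
      have "z \<in> N u" using w 5 KD[OF z] in_N by auto
      then show ?thesis using ou zT 5 by auto
    qed (use w in simp)
  qed
  have big3: "card (N z) \<ge> 3" if "z \<in> K" for z using deg_ge_3[OF KD[OF that]] card_N[of z] by simp
  have le: "card (N z) \<le> 1 + (if z = a then 1 else 0) + (if z = b then 1 else 0) + (if z = bv then 1 else 0)"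
    if z: "z \<in> K" for z
  proof -
    have "card (K - {z}) = 1" using \<open>card K = 2\<close> z fK by simp
    moreover have "finite (K - {z})" using fK by simp
    moreover have "card (N z) \<le> card ((K - {z}) \<union> (if z = a then {y} else {}) \<union> (if z = b then {x} else {})
      \<union> (if z = bv then {u} else {}))"
      using nbK[OF z] fK by (intro card_mono) auto
    moreover have "\<dots> \<le> card (K - {z}) + card (if z = a then {y} else {}) + card (if z = b then {x} else {})
      + card (if z = bv then {u} else {})"
      by (meson card_Un_le add_le_mono1 le_trans)
    ultimately show ?thesis by (auto split: if_splits)
  qed
  have "a \<in> K" "b \<in> K" "bv \<in> K" unfolding K_def by auto
  moreover have "\<not> (a = b \<and> b = bv)" using \<open>card K = 2\<close> unfolding K_def by auto
  ultimately show False 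
    using le[of a] le[of b] le[of bv] big3[of a] big3[of b] big3[of bv]
    by (cases "a = b"; cases "b = bv"; cases "a = bv") auto
qed

lemma strong_split: "card (strong x) = 2 + card (strong x - T)" "card (strong y) = 2 + card (strong y - T)"
proof -
  have "strong x = {y, v} \<union> (strong x - T)" "strong y = {x, v} \<union> (strong y - T)"
    using strong_mem strongD(4)[of _ x] strongD(4)[of _ y] by auto
  moreover have "card ({y, v} \<union> (strong x - T)) = card {y, v} + card (strong x - T)"
    "card ({x, v} \<union> (strong y - T)) = card {x, v} + card (strong y - T)"
    by (intro card_Un_disjoint; auto)+
  ultimately show "card (strong x) = 2 + card (strong x - T)" "card (strong y) = 2 + card (strong y - T)"
    using vertices by simp_all
qed

end

text \<open>The roles of \<open>x\<close> and \<open>y\<close> are symmetric, so each configuration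
  is excluded in one orientation and the mirrored fact comes for free.\<close>

sublocale bad_triangle \<subseteq> swapped: bad_triangle V adj sg y x v
  by unfold_locales (use A sv xy in auto)

context bad_triangle
begin

text \<open>Otherwise, for m and n outer strong neighbours, 2m + 2n plus the number of weak
  neighbours is at most 4, while degree three forces an outer neighbour at both \<open>x\<close> and
  \<open>y\<close>. Up to symmetry this leaves four cases, all excluded above.\<close>

lemma excess_pair: "excess x + excess y \<le> -1"
proof (rule ccontr)
  assume neg: "\<not> ?thesis"
  define m n where "m = card (strong x - T)" and "n = card (strong y - T)"
  have fin2: "finite (strong x - T)" "finite (strong y - T)" by simp_all
  have e: "2 * m + 2 * n + card (weak x) + card (weak y) \<le> 4"
    using neg strong_split unfolding excess_def m_def n_def by simp
  have d: "m + card (weak x) \<ge> 1" "n + card (weak y) \<ge> 1"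
    using deg_ge_3[of x] deg_ge_3[of y] vertices strong_split unfolding m_def n_def by auto
  have T': "{y, x, v} = T" by auto
  have z: "m = 0 \<longleftrightarrow> strong x \<subseteq> T" "n = 0 \<longleftrightarrow> strong y \<subseteq> T"
    using fin2 unfolding m_def n_def by auto
  have o: "m = 1 \<Longrightarrow> \<exists>a. strong x - T = {a}" "n = 1 \<Longrightarrow> \<exists>a. strong y - T = {a}"
    unfolding m_def n_def by (simp_all add: card_1_singleton_iff)
  have w0: "card (weak z) = 0 \<longleftrightarrow> weak z = {}" for z by simp
  have w1: "card (weak z) = 1 \<Longrightarrow> \<exists>a. weak z = {a}" for z by (simp add: card_1_singleton_iff)
  consider "m = 0" "n = 0" | "m = 0" "n = 1" "card (weak x) \<in> {1, 2}" "card (weak y) = 0"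
    | "m = 0" "n = 1" "card (weak x) = 1" "card (weak y) = 1"
    | "m = 1" "n = 0" "card (weak y) \<in> {1, 2}" "card (weak x) = 0"
    | "m = 1" "n = 0" "card (weak y) = 1" "card (weak x) = 1"
    | "m = 1" "n = 1" "card (weak x) = 0" "card (weak y) = 0"
  proof -
    have "m \<le> 2" "n \<le> 2" using e by auto
    then have "m = 0 \<or> m = 1 \<or> m = 2" "n = 0 \<or> n = 1 \<or> n = 2" by auto
    moreover have "card (weak x) = 0 \<or> card (weak x) = 1 \<or> card (weak x) = 2 \<or> card (weak x) > 2"
      "card (weak y) = 0 \<or> card (weak y) = 1 \<or> card (weak y) = 2 \<or> card (weak y) > 2" by arith+
    ultimately show thesis using that e d by (elim disjE) (simp_all del: card_0_eq card_eq_0_iff)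
  qed
  then show False
  proof cases
    case 1 then show ?thesis using weak_sum z e by auto
  next
    case 2 then show ?thesis using not_one_two z o w0 by metis
  next
    case 3 then show ?thesis using not_one_one_one z o w1 by metis
  next
    case 4 then show ?thesis using swapped.not_one_two z o w0 T' by metis
  next
    case 5 then show ?thesis using swapped.not_one_one_one z o w1 T' by metis
  next
    case 6 then show ?thesis using not_two_strong o w0 by metis
  qed
qed

end

section \<open>Discharging\<close>

context bad_triangle
begin

lemma T_adj: "a \<in> T \<Longrightarrow> b \<in> T \<Longrightarrow> a \<noteq> b \<Longrightarrow> adj a b"
  using edges by blast

lemma card_T: "card T = 3"
  using vertices xy by simp

lemma T_not_Bs: "T \<inter> Bs = {}"
  using strong_split A unfolding Bs_def badB_def badA_def by auto

lemma nb_Bs_v: "nb adj Bs v = {}"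
proof -
  have "nb adj Bs v \<subseteq> strong v" using Bs_sub unfolding nb_def strong_def by auto
  then have "nb adj Bs v \<subseteq> T \<inter> Bs" using sv unfolding nb_def by auto
  then show ?thesis using T_not_Bs by simp
qed

text \<open>If a weak neighbour \<open>u\<close> of \<open>b\<close> ended at \<open>y\<close> or
  \<open>v\<close>, the triangle with \<open>b\<close> and \<open>u\<close> would have potential at
  most 3 + 1 - 1 = 3. But two more weak neighbours of \<open>b\<close> lie outside, so
  \<open>pot_ge_4\<close> applies.\<close>

lemma ends_of_avoid_T:
  assumes b: "b \<in> nb adj Bs x"
  shows "ends_of b \<subseteq> insert x (strong x - {b, y, v})"
proof -
  have bB: "badB b" "b \<in> V - D2" "adj b x" using b Bs_sub adj_commute unfolding nb_def Bs_def by auto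
  have bs: "b \<in> strong x" using bB adj_commute in_N unfolding strong_def by blast
  have bT: "b \<notin> T" using b T_not_Bs unfolding nb_def by auto
  have "oth u b \<notin> {y, v}" if u: "u \<in> weak b" for u
  proof
    assume o: "oth u b \<in> {y, v}"
    note n = weak_oth[OF bB(2) u]
    have TD: "T \<inter> D2 = {}" "T \<subseteq> V" using vertices by auto
    have "pot adj (insert b T) \<le> pot adj T + 3 - 2 * int 1"
      by (rule pot_insert_le[OF _ _ ss, of _ _ "{x}"]) (use bT bB(3) in \<open>auto simp: nb_def\<close>)
    moreover have "pot adj (insert u (insert b T)) \<le> pot adj (insert b T) + 3 - 2 * int 2"
    proof (rule pot_insert_le[OF _ _ ss, of _ _ "{b, oth u b}"])
      show "u \<notin> insert b T" using n(4) bB(2) TD by blast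
      show "{b, oth u b} \<subseteq> nb adj (insert b T) u" using n(5,7) o unfolding nb_def by auto
      show "card {b, oth u b} = 2" using n(2) by auto
    qed simp
    ultimately have p3: "pot adj (insert u (insert b T)) \<le> 3" using pot_T by simp
    have "card (weak b - {u}) = 2" using bB(1) u unfolding badB_def by simp
    then obtain p q where pq: "weak b - {u} = {p, q}" "p \<noteq> q" by (auto simp: card_2_iff)
    have pqD: "p \<in> D2" "q \<in> D2" "p \<noteq> u" "q \<noteq> u" using pq unfolding weak_def by auto
    have "pot adj (insert u (insert b T)) \<ge> 4"
    proof (rule pot_ge_4)
      show "insert u (insert b T) \<subseteq> V" using n(8) bB(2) TD by blast
      have "card (insert b T) \<le> card (insert u (insert b T))" by (intro card_mono) auto
      then show "4 \<le> card (insert u (insert b T))" using bT card_T by simp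
      show "p \<in> V - insert u (insert b T)" "q \<in> V - insert u (insert b T)"
        using pqD D2_sub bB(2) TD by blast+
    qed (rule pq(2))
    then show False using p3 by simp
  qed
  then show ?thesis
    using ends_of_sub[OF vertices(1) bs bB(1)] unfolding ends_of_def by blast
qed

text \<open>Far ends avoid \<open>y\<close> and \<open>v\<close>, so a type B neighbour forces at
  least two further strong neighbours of \<open>x\<close>, five in all. With exactly five there is
  no room for three far ends, and everything lies in \<open>B1 x\<close>, offset by weak neighbours.
  With s at least 6, there being at most s - 2 type B neighbours is enough.\<close>

lemma excess_with_Bs:
  assumes ne: "nb adj Bs x \<noteq> {}"
  shows "excess x + int (card (nb adj Bs x)) \<le> -2"
proof -
  have xV: "x \<in> V - D2" by (rule vertices)
  have sub: "nb adj Bs x \<subseteq> strong x - {y, v}"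
    using Bs_sub T_not_Bs unfolding nb_def strong_def by auto
  then have "card (nb adj Bs x) \<le> card (strong x - {y, v})" by (intro card_mono) auto
  moreover have "card (strong x - {y, v}) = card (strong x) - 2"
    using strong_mem vertices by (subst card_Diff_subset) auto
  ultimately have b: "card (nb adj Bs x) \<le> card (strong x) - 2" by simp
  have room: "card (strong x) = card (strong x - {b, y, v}) + 3" if "b \<in> nb adj Bs x" for b
  proof -
    have "b \<in> strong x" "b \<noteq> y" "b \<noteq> v" using that sub by auto
    then have "{b, y, v} \<subseteq> strong x" "card {b, y, v} = 3" using strong_mem vertices by auto
    then show ?thesis using card_Diff_subset[of "{b, y, v}" "strong x"] card_mono[of "strong x" "{b, y, v}"]
      by simp
  qed
  obtain b0 where b0: "b0 \<in> nb adj Bs x" using ne by blast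
  have s5: "card (strong x) \<ge> 5"
  proof -
    have "badB b0" using b0 unfolding nb_def Bs_def by simp
    then have "card (ends_of b0) = 3" by (rule card_ends_of)
    then have "2 \<le> card (ends_of b0 - {x})"
      using diff_card_le_card_Diff[of "{x}" "ends_of b0"] by simp
    also have "\<dots> \<le> card (strong x - {b0, y, v})"
      using ends_of_avoid_T[OF b0] by (intro card_mono) auto
    finally show ?thesis using room[OF b0] by simp
  qed
  show ?thesis
  proof (cases "card (strong x) = 5")
    case True
    have "B2 x = {}"
    proof (rule ccontr)
      assume "B2 x \<noteq> {}"
      then obtain b where bb: "b \<in> B2 x" by blast
      then have bn: "b \<in> nb adj Bs x" and x: "x \<notin> ends_of b" "badB b"
        unfolding nb_Bs[OF xV] B2_def by auto
      have "ends_of b \<subseteq> strong x - {b, y, v}" using ends_of_avoid_T[OF bn] x by blast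
      then have "card (ends_of b) \<le> card (strong x - {b, y, v})" by (intro card_mono) auto
      then show False using room[OF bn] card_ends_of[OF x(2)] True by simp
    qed
    then have "card (nb adj Bs x) \<le> card (weak x)" using nb_Bs[OF xV] card_B1[OF xV] by simp
    then show ?thesis using True unfolding excess_def by simp
  next
    case False
    then show ?thesis using s5 b unfolding excess_def by simp
  qed
qed

lemma excess_one: "excess x + int (card (nb adj Bs x)) \<le> 1"
proof (cases "nb adj Bs x = {}")
  case True
  then show ?thesis using strong_split(1) deg_ge_3[OF vertices(1)] unfolding excess_def by simp
next
  case False
  then show ?thesis using excess_with_Bs by simp
qed

end

context bad_triangle
begin

lemma sum_T: "(\<Sum>z\<in>T. excess z + int (card (nb adj Bs z))) \<le> 0"
proof -
  have "excess v = 1" using A unfolding excess_def badA_def by simp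
  \<comment> \<open>If \<open>x\<close> or \<open>y\<close> has a type B neighbour, its term is at
    most -2 and the other one at most 1.\<close>
  moreover have "(excess x + int (card (nb adj Bs x))) + (excess y + int (card (nb adj Bs y))) \<le> -1"
  proof (cases "nb adj Bs x = {} \<and> nb adj Bs y = {}")
    case True
    then show ?thesis using excess_pair by simp
  next
    case False
    then show ?thesis
      using excess_with_Bs swapped.excess_with_Bs excess_one swapped.excess_one by linarith
  qed
  ultimately show ?thesis using nb_Bs_v vertices xy by simp
qed

end

section \<open>Disjointness of the triangles and the final count\<close>

context minimal_counterexample
begin

text \<open>By \<open>no_two\<close> two such triangles share only one vertex \<open>z\<close>, and
  their union has five vertices and potential at most 3. Two missing vertices are then impossible,
  so the weak neighbours of \<open>v\<close> and \<open>v'\<close> coincide. Adding this vertex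
  gives potential at most 2, hence all of V, and a vertex of the first triangle other than
  \<open>z\<close> and \<open>v\<close> has degree at most two.\<close>

lemma triangles_disjoint:
  assumes t: "bad_triangle V adj sg x y v" and t': "bad_triangle V adj sg x' y' v'"
    and ne: "{x, y, v} \<noteq> {x', y', v'}"
  shows "{x, y, v} \<inter> {x', y', v'} = {}"
proof (rule ccontr)
  interpret A: bad_triangle V adj sg x y v by (rule t)
  interpret B: bad_triangle V adj sg x' y' v' by (rule t')
  define P Q where "P = {x, y, v}" and "Q = {x', y', v'}"
  have PV: "P \<subseteq> V - D2" "Q \<subseteq> V - D2" using A.vertices B.vertices unfolding P_def Q_def by auto
  have c3: "card P = 3" "card Q = 3" "finite P" "finite Q"
    using A.card_T B.card_T unfolding P_def Q_def by simp_all
  assume "{x, y, v} \<inter> {x', y', v'} \<noteq> {}"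
  then obtain z where z: "z \<in> P" "z \<in> Q" unfolding P_def Q_def by blast
  have no2: False if "d \<in> Q - P" "a \<in> P" "b \<in> P" "a \<noteq> b" "adj d a" "adj d b" for a b d
    using A.no_two[of d a b] that PV unfolding P_def by blast
  have "card (Q - {z}) = 2" using c3 z by simp
  then obtain a b where ab: "Q - {z} = {a, b}" "a \<noteq> b" by (auto simp: card_2_iff)
  have Qab: "Q = {z, a, b}" "a \<noteq> z" "b \<noteq> z" using ab z by auto
  have aj: "adj a z" "adj b z" "adj b a" "adj a b"
    using B.T_adj Qab ab unfolding Q_def[symmetric] by auto
  have "\<not> Q \<subseteq> P" using ne c3 card_subset_eq[of P Q] unfolding P_def[symmetric] Q_def[symmetric] by auto
  then have abP: "a \<notin> P" "b \<notin> P"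
    using no2[of a z b] no2[of b z a] aj z ab Qab by auto
  have "pot adj (insert a P) \<le> pot adj P + 3 - 2 * int 1"
    by (rule pot_insert_le[OF _ _ ss, of _ _ "{z}"]) (use c3 abP z aj in \<open>auto simp: nb_def\<close>)
  moreover have "pot adj (insert b (insert a P)) \<le> pot adj (insert a P) + 3 - 2 * int 2"
    by (rule pot_insert_le[OF _ _ ss, of _ _ "{z, a}"])
      (use c3 abP z aj ab Qab in \<open>auto simp: nb_def\<close>)
  ultimately have p3: "pot adj (insert b (insert a P)) \<le> 3" using A.pot_T unfolding P_def by simp
  define R where "R = insert b (insert a P)"
  have R: "R \<subseteq> V - D2" "card R = 5" "finite R" "Q \<subseteq> R"
    using PV Qab c3 abP ab z unfolding R_def by auto
  obtain u where u: "weak v = {u}" by (rule A.card_weak_v)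
  obtain u' where u': "weak v' = {u'}" by (rule B.card_weak_v)
  have uu: "u \<in> V - R" "u' \<in> V - R" "u \<in> D2" "adj u v" "adj u' v'"
    using weak_oth[OF A.vertices(3), of u] weak_oth[OF B.vertices(3), of u'] u u' R(1) by auto
  have "u = u'"
  proof (rule ccontr)
    assume "u \<noteq> u'"
    then have "pot adj R \<ge> 4" using pot_ge_4[of R u u'] R uu by auto
    then show False using p3 unfolding R_def by simp
  qed
  have "v \<noteq> v'"
  proof
    assume "v = v'"
    then have "{x, y} = {x', y'}" using A.sv B.sv by simp
    then show False using ne \<open>v = v'\<close> by auto
  qed
  have "pot adj (insert u R) \<le> pot adj R + 3 - 2 * int 2"
    by (rule pot_insert_le[OF _ _ ss, of _ _ "{v, v'}"])
      (use R uu \<open>u = u'\<close> \<open>v \<noteq> v'\<close> in \<open>auto simp: nb_def R_def P_def Q_def\<close>)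
  then have "pot adj (insert u R) \<le> 2" using p3 unfolding R_def by simp
  moreover have "card (insert u R) \<ge> 4" using R uu by simp
  moreover have "insert u R \<subseteq> V" using R uu by blast
  ultimately have V: "V \<subseteq> insert u R" using pot_ge_3[of "insert u R"] by (cases "insert u R = V") auto
  have "card (P - {z, v}) \<ge> 1"
    using diff_card_le_card_Diff[of "{z, v}" P] c3 card_insert_le_m1[of 2 "{v}" z] by simp
  then have "P - {z, v} \<noteq> {}" by force
  then obtain c where c: "c \<in> P" "c \<noteq> z" "c \<noteq> v" by blast
  have "N c \<subseteq> P - {c}"
  proof
    fix w assume "w \<in> N c"
    then have w: "w \<in> V" "adj w c" "w \<noteq> c" using in_N adj_commute by auto
    have "w \<noteq> u"
    proof
      assume "w = u"
      then have "{v, v', c} \<subseteq> N u"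
        using uu \<open>u = u'\<close> w c PV A.vertices B.vertices in_N by auto
      then have "card {v, v', c} \<le> card (N u)" by (intro card_mono) auto
      moreover have "c \<noteq> v'" using c Qab abP B.vertices z unfolding Q_def by auto
      ultimately show False using uu(3) c \<open>v \<noteq> v'\<close> unfolding D2_def by auto
    qed
    moreover have "w \<noteq> a" "w \<noteq> b"
      using no2[of a z c] no2[of b z c] aj w c z Qab abP by auto
    ultimately show "w \<in> P - {c}" using V w unfolding R_def by blast
  qed
  then have "card (N c) \<le> card (P - {c})" using c3 by (intro card_mono) auto
  then have "card (N c) \<le> 2" using c c3 by simp
  moreover have "c \<in> V - D2" using c PV by blast
  ultimately show False using deg_ge_3[of c] card_N[of c] by simp
qed

lemma contradiction: False
proof -
  \<comment> \<open>Every type B vertex hands its surplus 1 to its only strong neighbour, which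
    leaves the total unchanged.\<close>
  define c where "c z = excess z + int (card (nb adj Bs z)) - (if z \<in> Bs then 1 else 0)" for z
  \<comment> \<open>Triangles are kept as vertex sets, so one with several type A vertices is
    counted once.\<close>
  define \<T> where "\<T> = {{x, y, v} | x y v. bad_triangle V adj sg x y v}"
  have TV: "t \<subseteq> V - D2" "finite t" if "t \<in> \<T>" for t
    using that bad_triangle.vertices unfolding \<T>_def by fastforce+
  have fT: "finite \<T>" using TV(1) fin by (intro finite_subset[of \<T> "Pow V"]) auto
  have sumT: "(\<Sum>z\<in>t. c z) \<le> 0" if tT: "t \<in> \<T>" for t
  proof -
    obtain x y v where t: "t = {x, y, v}" "bad_triangle V adj sg x y v"
      using tT unfolding \<T>_def by blast
    have "(\<Sum>z\<in>t. c z) = (\<Sum>z\<in>t. excess z + int (card (nb adj Bs z)))"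
      using bad_triangle.T_not_Bs[OF t(2)] unfolding t(1) c_def by (intro sum.cong) auto
    then show ?thesis using bad_triangle.sum_T[OF t(2)] t(1) by simp
  qed
  have rest: "c z \<le> 0" if z: "z \<in> V - D2" "z \<notin> \<Union>\<T>" for z
  proof -
    have "\<not> badA z"
    proof
      assume A: "badA z"
      then obtain x y where "strong z = {x, y}" "x \<noteq> y" unfolding badA_def by (auto simp: card_2_iff)
      then have "bad_triangle V adj sg x y z" using A by unfold_locales
      then show False using z unfolding \<T>_def by blast
    qed
    then have e: "excess z \<le> (if badB z then 1 else 0)" using excess_le z by blast
    show ?thesis
    proof (cases "nb adj Bs z = {}")
      case True
      then show ?thesis using e unfolding c_def Bs_def by auto
    next
      case False
      then show ?thesis using excess_Bs[OF z(1) False] unfolding c_def by simp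
    qed
  qed
  have "(\<Sum>z\<in>\<Union>\<T>. c z) = (\<Sum>t\<in>\<T>. \<Sum>z\<in>t. c z)"
  proof (subst sum.Union_disjoint)
    show "\<forall>t\<in>\<T>. \<forall>t'\<in>\<T>. t \<noteq> t' \<longrightarrow> t \<inter> t' = {}"
    proof (intro ballI impI)
      fix t t' assume "t \<in> \<T>" "t' \<in> \<T>" and ne: "t \<noteq> t'"
      then obtain x y v x' y' v' where "t = {x, y, v}" "bad_triangle V adj sg x y v"
        "t' = {x', y', v'}" "bad_triangle V adj sg x' y' v'" unfolding \<T>_def by blast
      then show "t \<inter> t' = {}" using triangles_disjoint ne by blast
    qed
  qed (use TV in auto)
  also have "\<dots> \<le> 0" using sumT by (rule sum_nonpos)
  finally have s1: "(\<Sum>z\<in>\<Union>\<T>. c z) \<le> 0" .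
  have s2: "(\<Sum>z\<in>(V - D2) - \<Union>\<T>. c z) \<le> 0" using rest by (intro sum_nonpos) auto
  have "(\<Sum>z\<in>V - D2. c z) = (\<Sum>z\<in>(V - D2) - \<Union>\<T>. c z) + (\<Sum>z\<in>\<Union>\<T>. c z)"
    using TV fin by (intro sum.subset_diff) auto
  then have "(\<Sum>z\<in>V - D2. c z) \<le> 0" using s1 s2 by simp
  moreover have "(\<Sum>z\<in>V - D2. c z) = 2 * pot adj V"
  proof -
    have "(\<Sum>z\<in>V - D2. (if z \<in> Bs then 1 else 0 :: int)) = int (card Bs)"
      using Bs_sub fin by (simp add: sum.If_cases Int_absorb1)
    moreover have "(\<Sum>z\<in>V - D2. int (card (nb adj Bs z))) = int (card Bs)"
      using sum_Bs by (simp flip: of_nat_sum)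
    ultimately show ?thesis
      using sum_excess unfolding c_def by (simp add: sum_subtractf sum.distrib)
  qed
  ultimately show False using big by simp
qed

end

text \<open>The induction generalizes over the relations as well, since contractions and imposed
  edges change them.\<close>

lemma pot_critical:
  fixes V :: "'v set"
  assumes "finite V" "simple_signed adj sg" "\<not> colorable adj sg V"
    "\<And>S. S \<subset> V \<Longrightarrow> colorable adj sg S"
  shows "pot adj V \<le> 1"
  using assms
proof (induction "card V" arbitrary: V adj sg rule: less_induct)
  case less
  show ?case
  proof (rule ccontr)
    assume "\<not> pot adj V \<le> 1"
    then have "minimal_counterexample V adj sg"
      using less by unfold_locales auto
    then show False by (rule minimal_counterexample.contradiction)
  qed
qed

section \<open>Homomorphisms to the target as colourings\<close>

text \<open>Chinese remaindering: divisibility by 3 says that the image edge is a loop, which is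
  negative, and the parity says whether the ends are switched alike. The sign is positive if exactly
  one of the two conditions holds.\<close>

lemma far_iff_parity: "far d \<longleftrightarrow> even d \<noteq> (3 dvd d)"
proof -
  have "even d \<longleftrightarrow> even (d mod 6)" "3 dvd d \<longleftrightarrow> 3 dvd d mod 6"
    by (simp_all add: dvd_mod_iff)
  moreover have "\<forall>r\<in>{0, 1, 2, 3, 4, 5 :: int}. (r \<in> {2, 3, 4}) = (even r \<noteq> (3 dvd r))"
    by code_simp
  ultimately show ?thesis using mod_6_cases[of d] unfolding far_def by metis
qed

lemma esign_C3star: "esign C3star e = (if card e = 1 then -1 else 1)"
  and ends_C3star: "ends C3star e = e"
  and verts_C3star: "verts C3star = {0, 1, 2}"
  and edges_C3star: "edges C3star = {{0, 1}, {1, 2}, {0, 2}, {0}, {1}, {2}}"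
  unfolding C3star_def by simp_all

lemma pair_in_edges_C3star:
  assumes "a \<in> {0, 1, 2}" "b \<in> {0, 1, 2}"
  shows "{a, b} \<in> edges C3star"
  using assms unfolding edges_C3star by auto

lemma edge_ends:
  assumes "signed_graph G" "e \<in> edges G"
  obtains u w where "ends G e = {u, w}" "u \<in> verts G" "w \<in> verts G"
proof -
  have "ends G e \<subseteq> verts G" "card (ends G e) = 1 \<or> card (ends G e) = 2"
    using assms unfolding signed_graph_def by auto
  then show thesis using that by (auto simp: card_1_singleton_iff card_2_iff)
qed

lemma esign_cases: "signed_graph G \<Longrightarrow> e \<in> edges G \<Longrightarrow> esign G e = 1 \<or> esign G e = -1"
  unfolding signed_graph_def by blast

definition proper_coloring :: "('v, 'e) signed_graph \<Rightarrow> ('v \<Rightarrow> int) \<Rightarrow> bool" where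
  "proper_coloring G f \<longleftrightarrow>
     (\<forall>e\<in>edges G. \<forall>u w. ends G e = {u, w} \<longrightarrow> far (f u - f w) = (esign G e = 1))"

text \<open>The switching signs \<open>\<tau>\<close> telescope along a walk and cancel on a closed
  one.\<close>

lemma coloring_maps_to:
  assumes G: "signed_graph G" and f: "proper_coloring G f"
  shows "maps_to G C3star"
proof -
  define h where "h v = nat (f v mod 3)" for v
  define g where "g e = h ` ends G e" for e
  define \<tau> :: "'a \<Rightarrow> int" where "\<tau> v = (if even (f v) then 1 else -1)" for v
  have h: "h v \<in> {0, 1, 2}" for v
  proof -
    have "0 \<le> f v mod 3" "f v mod 3 < 3" by simp_all
    then show ?thesis unfolding h_def by auto
  qed
  have heq: "h u = h w \<longleftrightarrow> 3 dvd f u - f w" for u w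
    unfolding h_def by (simp add: eq_nat_nat_iff mod_eq_dvd_iff)
  have gE: "g e \<in> edges C3star" if e: "e \<in> edges G" for e
  proof -
    obtain u w where "ends G e = {u, w}" by (rule edge_ends[OF G e])
    then have "g e = {h u, h w}" unfolding g_def by simp
    then show ?thesis using pair_in_edges_C3star[OF h h] by simp
  qed
  have sign: "esign G e = \<tau> u * \<tau> w * esign C3star (g e)"
    if e: "e \<in> edges G" "ends G e = {u, w}" for e u w
  proof -
    have "card (g e) = 1 \<longleftrightarrow> h u = h w" unfolding g_def e(2) by (auto simp: card_insert_if)
    moreover have "esign G e = 1 \<longleftrightarrow> even (f u - f w) \<noteq> (h u = h w)"
      using f e unfolding proper_coloring_def far_iff_parity heq by blast
    ultimately show ?thesis
      using esign_cases[OF G e(1)] unfolding \<tau>_def esign_C3star by (auto split: if_splits)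
  qed
  have \<tau>2: "\<tau> v * \<tau> v = 1" for v unfolding \<tau>_def by simp
  have ws: "walk_sign G es = \<tau> u * \<tau> w * walk_sign C3star (map g es)" if "walk G u es w" for u es w
    using that
  proof (induction es arbitrary: u)
    case Nil
    then show ?case using \<tau>2 unfolding walk_sign_def by simp
  next
    case (Cons e es)
    then obtain z where z: "e \<in> edges G" "ends G e = {u, z}" "walk G z es w" by auto
    have "walk_sign G (e # es) = esign G e * walk_sign G es" unfolding walk_sign_def by simp
    also have "\<dots> = (\<tau> u * \<tau> z * esign C3star (g e)) * (\<tau> z * \<tau> w * walk_sign C3star (map g es))"
      using sign[OF z(1,2)] Cons.IH[OF z(3)] by simp
    also have "\<dots> = (\<tau> z * \<tau> z) * (\<tau> u * \<tau> w * (esign C3star (g e) * walk_sign C3star (map g es)))"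
      by (simp add: algebra_simps)
    also have "\<dots> = \<tau> u * \<tau> w * walk_sign C3star (map g (e # es))"
      unfolding \<tau>2 walk_sign_def by simp
    finally show ?case .
  qed
  have "homomorphism G C3star h"
    unfolding homomorphism_def
  proof (intro conjI bexI[of _ g] ballI allI impI)
    show "h \<in> verts G \<rightarrow> verts C3star" using h unfolding verts_C3star by blast
    show "g \<in> edges G \<rightarrow> edges C3star" using gE by blast
    show "ends C3star (g e) = h ` ends G e" for e unfolding ends_C3star g_def ..
    show "walk_sign C3star (map g es) = walk_sign G es" if "walk G v es v" for v es
      using ws[OF that] \<tau>2 by simp
  qed
  then show ?thesis unfolding maps_to_def by blast
qed

lemma walk_append: "walk G u es w \<Longrightarrow> walk G w es' z \<Longrightarrow> walk G u (es @ es') z"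
  by (induction es arbitrary: u) auto

lemma walk_rev: "signed_graph G \<Longrightarrow> walk G u es w \<Longrightarrow> walk G w (rev es) u"
proof (induction es arbitrary: u)
  case (Cons e es)
  then obtain z where z: "e \<in> edges G" "ends G e = {u, z}" "walk G z es w" by auto
  then have "u \<in> verts G" using Cons.prems(1) unfolding signed_graph_def by blast
  then have "walk G z [e] u" using z by auto
  then show ?case using walk_append Cons.IH[OF Cons.prems(1) z(3)] by fastforce
qed auto

text \<open>The sign of an edge times that of its image multiplies to 1 along every closed walk.
  Hence it is a coboundary: \<open>\<tau>\<close> is its product along a path from a root, and on an
  edge it is the product of \<open>\<tau>\<close> at the two ends.\<close>

lemma maps_to_coloring:
  assumes G: "signed_graph G" and "maps_to G C3star"
  obtains f where "proper_coloring G f"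
proof -
  obtain h g where h: "h \<in> verts G \<rightarrow> verts C3star"
    and ge': "\<forall>e\<in>edges G. g e = h ` ends G e"
    and cw': "\<forall>v es. walk G v es v \<longrightarrow> walk_sign C3star (map g es) = walk_sign G es"
    using assms(2) unfolding maps_to_def homomorphism_def ends_C3star by (elim exE conjE bexE)
  note ge = bspec[OF ge'] and cw = cw'[rule_format]
  define c where "c e = esign G e * esign C3star (g e)" for e
  define \<pi> where "\<pi> es = prod_list (map c es)" for es
  have \<pi>: "\<pi> es = walk_sign G es * walk_sign C3star (map g es)" for es
    unfolding \<pi>_def c_def walk_sign_def by (induction es) (simp_all add: algebra_simps)
  have sq: "walk_sign G es = 1 \<or> walk_sign G es = -1" if "walk G u es w" for u es w
    using that
  proof (induction es arbitrary: u)
    case (Cons e es)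
    then obtain z where z: "e \<in> edges G" "walk G z es w" by auto
    then show ?case using Cons.IH[OF z(2)] esign_cases[OF G z(1)] unfolding walk_sign_def by auto
  qed (simp add: walk_sign_def)
  have closed: "\<pi> es = 1" if "walk G v es v" for v es
    using sq[OF that] cw[OF that] unfolding \<pi> by auto
  \<comment> \<open>The choice depends only on which vertices reach \<open>v\<close>, so all
    vertices of a component receive the same root.\<close>
  define root where "root v = (SOME r. \<exists>es. walk G r es v)" for v
  define path where "path v = (SOME es. walk G (root v) es v)" for v
  define \<tau> where "\<tau> v = \<pi> (path v)" for v
  have path: "walk G (root v) (path v) v" if "v \<in> verts G" for v
  proof -
    have "\<exists>es. walk G v es v" using that by (intro exI[of _ "[]"]) simp
    then have "\<exists>r es. walk G r es v" by blast
    then have "\<exists>es. walk G (root v) es v" unfolding root_def by (rule someI_ex)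
    then show ?thesis unfolding path_def by (rule someI_ex)
  qed
  have c\<tau>: "c e = \<tau> u * \<tau> w \<and> (\<tau> u = 1 \<or> \<tau> u = -1) \<and> (\<tau> w = 1 \<or> \<tau> w = -1)"
    if e: "e \<in> edges G" "ends G e = {u, w}" for e u w
  proof -
    have uw: "u \<in> verts G" "w \<in> verts G" using e G unfolding signed_graph_def by auto
    have we: "walk G u [e] w" using e uw by auto
    have we': "walk G w [e] u" using walk_rev[OF G we] by simp
    have "(\<exists>es. walk G r es u) \<longleftrightarrow> (\<exists>es. walk G r es w)" for r
      using walk_append we we' by metis
    then have rt: "root u = root w" unfolding root_def by simp
    have "walk G (root u) (path u @ [e] @ rev (path w)) (root u)"
      using walk_append[OF path[OF uw(1)] walk_append[OF we walk_rev[OF G path[OF uw(2)]]]] rt by simp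
    from closed[OF this] have "\<tau> u * c e * \<tau> w = 1"
      unfolding \<tau>_def \<pi>_def by (simp add: prod_list.rev flip: rev_map)
    moreover have "c e = 1 \<or> c e = -1"
      using esign_cases[OF G e(1)] unfolding c_def esign_C3star by auto
    moreover have pm: "\<tau> z = 1 \<or> \<tau> z = -1" if "z \<in> {u, w}" for z
    proof -
      have "z \<in> verts G" using that uw by blast
      then have s: "walk_sign G (path z) = 1 \<or> walk_sign G (path z) = -1" by (rule sq[OF path])
      have "walk_sign C3star es = 1 \<or> walk_sign C3star es = -1" for es
        unfolding walk_sign_def by (induction es) (auto simp: esign_C3star)
      from s this[of "map g (path z)"] show ?thesis unfolding \<tau>_def \<pi> by auto
    qed
    ultimately show ?thesis using pm[of u] pm[of w] by auto
  qed
  \<comment> \<open>The multiple of 4 is even and lies in the class of \<open>h v\<close> modulo 3;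
    adding 3 changes the parity alone.\<close>
  define f where "f v = 4 * int (h v) + (if \<tau> v = 1 then 0 else 3)" for v
  have "far (f u - f w) = (esign G e = 1)" if e: "e \<in> edges G" "ends G e = {u, w}" for e u w
  proof -
    have uw: "u \<in> verts G" "w \<in> verts G" using e G unfolding signed_graph_def by auto
    have hh: "h u \<in> {0, 1, 2}" "h w \<in> {0, 1, 2}" 
      using Pi_mem[OF h uw(1)] Pi_mem[OF h uw(2)] unfolding verts_C3star by simp_all
    have "3 dvd f u - f w \<longleftrightarrow> h u = h w"
    proof -
      have "f u - f w = 3 * (int (h u) - int (h w) + (if \<tau> u = 1 then 0 else 1) - (if \<tau> w = 1 then 0 else 1))
          + (int (h u) - int (h w))"
        unfolding f_def by simp
      then have "3 dvd f u - f w \<longleftrightarrow> 3 dvd int (h u) - int (h w)"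
        by (metis dvd_add_right_iff dvd_triv_left)
      also have "\<dots> \<longleftrightarrow> h u = h w"
      proof -
        have "h u \<le> 2" "h w \<le> 2" using hh by auto
        then show ?thesis by presburger
      qed
      finally show ?thesis .
    qed
    moreover have "even (f u - f w) \<longleftrightarrow> (\<tau> u = 1 \<longleftrightarrow> \<tau> w = 1)" unfolding f_def by simp
    moreover have "card (g e) = 1 \<longleftrightarrow> h u = h w"
      using ge[OF e(1)] e(2) by (auto simp: card_insert_if)
    moreover note c\<tau>[OF e] esign_cases[OF G e(1)]
    ultimately show ?thesis unfolding far_iff_parity c_def esign_C3star by (auto split: if_splits)
  qed
  then show thesis using that unfolding proper_coloring_def by blast
qed

section \<open>From signed multigraphs to adjacency relations\<close>

definition adjacent :: "('v, 'e) signed_graph \<Rightarrow> 'v \<Rightarrow> 'v \<Rightarrow> bool" where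
  "adjacent G u v \<longleftrightarrow> u \<noteq> v \<and> (\<exists>e\<in>edges G. ends G e = {u, v})"

definition positive :: "('v, 'e) signed_graph \<Rightarrow> 'v \<Rightarrow> 'v \<Rightarrow> bool" where
  "positive G u v \<longleftrightarrow> (\<exists>e\<in>edges G. ends G e = {u, v} \<and> esign G e = 1)"

lemma simple_signed_graph: "simple_signed (adjacent G) (positive G)"
  unfolding simple_signed_def adjacent_def positive_def by (auto simp: insert_commute)

text \<open>The handshake count, only an inequality because parallel edges give one adjacency and
  loops none.\<close>

lemma links_adjacent:
  assumes G: "signed_graph G"
  shows "links (adjacent G) (verts G) (verts G) \<le> 2 * card (edges G)"
proof -
  have fin: "finite (verts G)" "finite (edges G)" using G unfolding signed_graph_def by auto
  have nb: "card (nb (adjacent G) (verts G) v) \<le> card {e \<in> edges G. v \<in> ends G e}" for v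
  proof (rule surj_card_le[of _ _ "\<lambda>e. the_elem (ends G e - {v})"])
    show "finite {e \<in> edges G. v \<in> ends G e}" using fin by simp
    show "nb (adjacent G) (verts G) v \<subseteq> (\<lambda>e. the_elem (ends G e - {v})) ` {e \<in> edges G. v \<in> ends G e}"
    proof
      fix w assume "w \<in> nb (adjacent G) (verts G) v"
      then obtain e where e: "v \<noteq> w" "e \<in> edges G" "ends G e = {v, w}"
        unfolding nb_def adjacent_def by blast
      then have "ends G e - {v} = {w}" by auto
      then show "w \<in> (\<lambda>e. the_elem (ends G e - {v})) ` {e \<in> edges G. v \<in> ends G e}"
        using e by (intro image_eqI[of _ _ e]) auto
    qed
  qed
  have "links (adjacent G) (verts G) (verts G) \<le> (\<Sum>v\<in>verts G. card {e \<in> edges G. v \<in> ends G e})"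
    unfolding links_def by (intro sum_mono nb)
  also have "\<dots> = (\<Sum>e\<in>edges G. card {v \<in> verts G. v \<in> ends G e})"
    using fin sum.swap[of "\<lambda>v e. if v \<in> ends G e then 1 else 0 :: nat" "edges G" "verts G"]
    by (simp add: sum.If_cases Int_def)
  also have "\<dots> \<le> (\<Sum>e\<in>edges G. 2)"
  proof (rule sum_mono)
    fix e assume "e \<in> edges G"
    then have e: "card (ends G e) \<le> 2" "ends G e \<subseteq> verts G" using G unfolding signed_graph_def by auto
    then have "{v \<in> verts G. v \<in> ends G e} = ends G e" by blast
    then show "card {v \<in> verts G. v \<in> ends G e} \<le> 2" using e by simp
  qed
  finally show ?thesis by simp
qed

lemma positive_edge:
  assumes "\<not> has_digon G" "e \<in> edges G" "ends G e = {u, w}"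
  shows "positive G u w \<longleftrightarrow> esign G e = 1"
  using assms unfolding positive_def has_digon_def by metis

theorem theorem1p5:
  fixes G :: "('v, 'e) signed_graph"
  assumes "C3star_critical G"
  shows "real (card (edges G)) \<ge> (3 * real (card (verts G)) - 1) / 2"
proof -
  have G: "signed_graph G" and nd: "\<not> has_digon G" and npl: "\<not> has_positive_loop G"
    and nm: "\<not> maps_to G C3star" and pm: "\<And>G'. proper_subgraph G' G \<Longrightarrow> maps_to G' C3star"
    using assms unfolding C3star_critical_def by auto
  have "\<not> colorable (adjacent G) (positive G) (verts G)"
  proof
    assume "colorable (adjacent G) (positive G) (verts G)"
    then obtain f where f: "good (adjacent G) (positive G) f (verts G)" unfolding colorable_def by blast
    have "far (f u - f w) = (esign G e = 1)" if e: "e \<in> edges G" "ends G e = {u, w}" for e u w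
    proof (cases "u = w")
      case True
      then have "esign G e \<noteq> 1" using npl e unfolding has_positive_loop_def by auto
      then show ?thesis using True by simp
    next
      case False
      then have "adjacent G u w" "u \<in> verts G" "w \<in> verts G"
        using e G unfolding adjacent_def signed_graph_def by auto
      then show ?thesis using f positive_edge[OF nd e] unfolding good_def by blast
    qed
    then have "proper_coloring G f" unfolding proper_coloring_def by blast
    then show False using coloring_maps_to[OF G] nm by blast
  qed
  moreover have "colorable (adjacent G) (positive G) S" if S: "S \<subset> verts G" for S
  proof -
    \<comment> \<open>The induced subgraph keeps every edge inside S, so its colouring respects all
      adjacencies there.\<close>
    define G' where "G' = G\<lparr>verts := S, edges := {e \<in> edges G. ends G e \<subseteq> S}\<rparr>"
    have "finite S" using S G finite_subset unfolding signed_graph_def by blast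
    then have G': "signed_graph G'" using G unfolding signed_graph_def G'_def by auto
    then have "proper_subgraph G' G"
      using G S unfolding proper_subgraph_def subgraph_def G'_def by auto
    then obtain f where f: "proper_coloring G' f" using maps_to_coloring[OF G'] pm by blast
    have "far (f u - f w) = positive G u w" if uw: "u \<in> S" "w \<in> S" "adjacent G u w" for u w
    proof -
      obtain e where e: "e \<in> edges G" "ends G e = {u, w}" using uw(3) unfolding adjacent_def by blast
      then have "e \<in> edges G'" "ends G' e = {u, w}" "esign G' e = esign G e"
        using uw unfolding G'_def by auto
      then show ?thesis using f positive_edge[OF nd e] unfolding proper_coloring_def by metis
    qed
    then show ?thesis unfolding colorable_def good_def by blast
  qed
  moreover have "finite (verts G)" using G unfolding signed_graph_def by blast
  ultimately have "pot (adjacent G) (verts G) \<le> 1" using simple_signed_graph by (intro pot_critical)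
  then have "3 * int (card (verts G)) \<le> 1 + 2 * int (card (edges G))"
    using links_adjacent[OF G] unfolding pot_def by linarith
  then have "3 * real (card (verts G)) \<le> 1 + 2 * real (card (edges G))" by linarith
  then show ?thesis by simp
qed

end
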